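(* Let $D\subset\mathbb R^{2,1}$ be a domain of dependence and $v$ a future-directed timelike unit vector. Consider the functions $\iota_v$ and $I_v$ on $P_v$. Then: \begin{itemize} \item the function $\iota_v$ is upper semicontinuous; \item the set of discontinuity points of $\iota_v$ is meagre; \item the function $I_v$ is upper semicontinuous. \end{itemize}
   Context: $\mathbb R^{2,1}$ is $\mathbb R^{3}$ with the Minkowski form $\langle x,x\rangle=-x_0^2+x_1^2+x_2^2$, time-oriented by $x_0$. A domain of dependence is an open convex domain $D$ which is the intersection of the futures of a family of lightlike planes, such that the complement of $D$ contains at least two non-parallel lightlike planes. The cosmological time $\tau:D\to(0,\infty)$ is the supremum of the Lorentzian lengths of causal curves in $D$ ending at the given point; it is finite and $C^{1,1}$. $P_v$ is the spacelike plane through $0$ orthogonal to $v$. The level surface $H_\epsilon=\tau^{-1}(\epsilon)$ is the graph $\{x+u_\epsilon(x)v: x\in P_v\}$ of a convex function $u_\epsilon$, and $\partial D$ is the graph $\{x+u(x)v : x\in P_v\}$ of a convex function $u=\lim_{\epsilon\to0}u_\epsilon$. With $\nu_\epsilon$ the future-directed unit normal of $H_\epsilon$, put $\iota_\epsilon(x)=-\epsilon\langle\nu_\epsilon(x+u_\epsilon(x)v),v\rangle$ and $\iota_v(x)=\lim_{\epsilon\to0}\iota_\epsilon(x)=\inf_{\epsilon>0}\iota_\epsilon(x)$ (the limit exists and is finite). Every $q\in\partial D$ lies on a lightlike ray contained in $\partial D$ which is maximal with respect to inclusion; such a ray is infinite in the future and has a past endpoint in $\partial D$, which is uniquely determined by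 $q$ and is denoted $\mathbf r_0(q)$. For $x\in P_v$ and $q=x+u(x)v$ put $I_v(x)=-\langle q-\mathbf r_0(q),v\rangle\ge 0$. *)

theory Defs
  imports "HOL-Analysis.Analysis"
begin

section \<open>Minkowski space\<close>

text \<open>The coordinates are \<open>x $ 0\<close>, \<open>x $ 1\<close>, \<open>x $ 2\<close>; in the index type \<open>3\<close>, the
  element \<open>0\<close> is the same as \<open>3\<close>, so the library's \<open>forall_3\<close>, \<open>sum_3\<close>, \<open>vector_3\<close> see the
  time coordinate as \<open>x $ 3\<close>.\<close>

definition mink :: "real^3 \<Rightarrow> real^3 \<Rightarrow> real" where
  "mink x y = - (x $ 0 * y $ 0) + x $ 1 * y $ 1 + x $ 2 * y $ 2"

definition future_timelike :: "real^3 \<Rightarrow> bool" where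
  "future_timelike w \<longleftrightarrow> mink w w < 0 \<and> w $ 0 > 0"

definition future_causal :: "real^3 \<Rightarrow> bool" where
  "future_causal w \<longleftrightarrow> mink w w \<le> 0 \<and> w $ 0 > 0"

definition lightlike :: "real^3 \<Rightarrow> bool" where
  "lightlike n \<longleftrightarrow> n \<noteq> 0 \<and> mink n n = 0"

definition future_of :: "(real^3) set \<Rightarrow> (real^3) set" where
  "future_of S = {y. \<exists>x\<in>S. future_timelike (y - x)}"

definition lightlike_plane :: "(real^3) set \<Rightarrow> bool" where
  "lightlike_plane P \<longleftrightarrow> (\<exists>n c. lightlike n \<and> P = {x. mink x n = c})"

definition parallel :: "(real^3) set \<Rightarrow> (real^3) set \<Rightarrow> bool" where
  "parallel P Q \<longleftrightarrow> (\<exists>a. Q = (+) a ` P)"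

definition domain_of_dependence :: "(real^3) set \<Rightarrow> bool" where
  "domain_of_dependence D \<longleftrightarrow>
     D \<noteq> {} \<and> open D \<and> convex D \<and>
     (\<exists>\<F>. (\<forall>P\<in>\<F>. lightlike_plane P) \<and> D = (\<Inter>P\<in>\<F>. future_of P)) \<and>
     (\<exists>P Q. lightlike_plane P \<and> lightlike_plane Q \<and> \<not> parallel P Q \<and>
            P \<subseteq> - D \<and> Q \<subseteq> - D)"

section \<open>Cosmological time and its level surfaces\<close>

definition causal_curve_to :: "(real^3) set \<Rightarrow> real^3 \<Rightarrow> (real \<Rightarrow> real^3) \<Rightarrow> bool" where
  "causal_curve_to D p \<gamma> \<longleftrightarrow>
     \<gamma> piecewise_C1_differentiable_on {0..1} \<and> \<gamma> ` {0..1} \<subseteq> D \<and> \<gamma> 1 = p \<and>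
     (\<exists>S. finite S \<and> (\<forall>t\<in>{0..1} - S. future_causal (vector_derivative \<gamma> (at t))))"

definition lorentz_length :: "(real \<Rightarrow> real^3) \<Rightarrow> real" where
  "lorentz_length \<gamma> = integral {0..1}
     (\<lambda>t. sqrt (- mink (vector_derivative \<gamma> (at t)) (vector_derivative \<gamma> (at t))))"

definition cosmological_time :: "(real^3) set \<Rightarrow> real^3 \<Rightarrow> ereal" where
  "cosmological_time D p = (SUP \<gamma>\<in>{\<gamma>. causal_curve_to D p \<gamma>}. ereal (lorentz_length \<gamma>))"

definition level_surface :: "(real^3) set \<Rightarrow> real \<Rightarrow> (real^3) set" where
  "level_surface D \<epsilon> = {p\<in>D. cosmological_time D p = ereal \<epsilon>}"

definition tangent_vectors :: "(real^3) set \<Rightarrow> real^3 \<Rightarrow> (real^3) set" where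
  "tangent_vectors S p =
     {w. \<exists>\<gamma>. \<gamma> 0 = p \<and> (\<gamma> has_vector_derivative w) (at 0) \<and> (\<forall>\<^sub>F t in at 0. \<gamma> t \<in> S)}"

definition future_unit_normal :: "(real^3) set \<Rightarrow> real^3 \<Rightarrow> real^3" where
  "future_unit_normal S p =
     (THE n. future_timelike n \<and> mink n n = -1 \<and> (\<forall>w\<in>tangent_vectors S p. mink n w = 0))"

section \<open>Graphs over the plane orthogonal to \<open>v\<close>\<close>

definition orth_plane :: "real^3 \<Rightarrow> (real^3) set" where
  "orth_plane v = {x. mink x v = 0}"

text \<open>If \<open>S\<close> is the graph \<open>{x + f x v | x \<in> P\<^sub>v}\<close>, then \<open>graph_height S v\<close> agrees with \<open>f\<close> on
  \<open>P\<^sub>v\<close>.\<close>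

definition graph_height :: "(real^3) set \<Rightarrow> real^3 \<Rightarrow> real^3 \<Rightarrow> real" where
  "graph_height S v x = (THE s. x + s *\<^sub>R v \<in> S)"

definition iota_eps :: "(real^3) set \<Rightarrow> real^3 \<Rightarrow> real \<Rightarrow> real^3 \<Rightarrow> real" where
  "iota_eps D v \<epsilon> x =
     - \<epsilon> * mink (future_unit_normal (level_surface D \<epsilon>)
                  (x + graph_height (level_surface D \<epsilon>) v x *\<^sub>R v)) v"

definition iota :: "(real^3) set \<Rightarrow> real^3 \<Rightarrow> real^3 \<Rightarrow> real" where
  "iota D v x = Lim (at_right 0) (\<lambda>\<epsilon>. iota_eps D v \<epsilon> x)"

section \<open>Maximal lightlike rays in the boundary\<close>

definition ray :: "real^3 \<Rightarrow> real^3 \<Rightarrow> (real^3) set" where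
  "ray p n = {p + t *\<^sub>R n | t. t \<ge> 0}"

definition lightlike_ray :: "(real^3) set \<Rightarrow> bool" where
  "lightlike_ray R \<longleftrightarrow> (\<exists>p n. lightlike n \<and> R = ray p n)"

definition maximal_lightlike_ray :: "(real^3) set \<Rightarrow> (real^3) set \<Rightarrow> bool" where
  "maximal_lightlike_ray B R \<longleftrightarrow>
     lightlike_ray R \<and> R \<subseteq> B \<and> (\<forall>R'. lightlike_ray R' \<and> R' \<subseteq> B \<and> R \<subseteq> R' \<longrightarrow> R' = R)"

text \<open>A point \<open>q\<close> may lie on several maximal lightlike rays, but these all start at the same
  point.\<close>

definition past_endpoint :: "(real^3) set \<Rightarrow> real^3 \<Rightarrow> real^3" where
  "past_endpoint D q =
     (THE p. \<exists>n. lightlike n \<and> n $ 0 > 0 \<and> q \<in> ray p n \<and>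
                 maximal_lightlike_ray (frontier D) (ray p n))"

definition I_fun :: "(real^3) set \<Rightarrow> real^3 \<Rightarrow> real^3 \<Rightarrow> real" where
  "I_fun D v x = (let q = x + graph_height (frontier D) v x *\<^sub>R v
                  in - mink (q - past_endpoint D q) v)"

section \<open>Semicontinuity and Baire category\<close>

definition upper_semicontinuous_on :: "'a::topological_space set \<Rightarrow> ('a \<Rightarrow> real) \<Rightarrow> bool" where
  "upper_semicontinuous_on S f \<longleftrightarrow> (\<forall>x\<in>S. \<forall>a>f x. \<forall>\<^sub>F y in at x within S. f y < a)"

definition nowhere_dense_in :: "'a topology \<Rightarrow> 'a set \<Rightarrow> bool" where
  "nowhere_dense_in X A \<longleftrightarrow> A \<subseteq> topspace X \<and> X interior_of (X closure_of A) = {}"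

definition meagre_in :: "'a topology \<Rightarrow> 'a set \<Rightarrow> bool" where
  "meagre_in X A \<longleftrightarrow> (\<exists>\<N>. countable \<N> \<and> (\<forall>N\<in>\<N>. nowhere_dense_in X N) \<and> A = \<Union>\<N>)"

end

theory Submission
  imports Defs
begin

text \<open>Every \<open>p\<close> in \<open>D\<close> has a point \<open>r\<close> of \<open>closure D\<close> in its past at maximal Lorentzian
  distance, and by convexity the plane through \<open>r\<close> orthogonal to \<open>p - r\<close> supports \<open>D\<close>. Hence the
  squared cosmological time \<open>T\<close> lies between \<open>- \<langle>p' - r, p' - r\<rangle>\<close> and
  \<open>\<langle>p' - r, p - r\<rangle>\<^sup>2 / T p\<close>, with equality of both bounds at \<open>p' = p\<close>. This sandwich gives the
  differentiability of \<open>T\<close>, identifies the unit normal of a level surface as the multiple of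
  \<open>p - r\<close>, and shows that \<open>- \<langle>p - r, v\<rangle>\<close> increases along lines in the direction \<open>v\<close>. So iota is the
  infimum of \<open>- \<langle>p - r, v\<rangle>\<close> over a line. Each of these values is half the derivative of \<open>T\<close> in
  the direction \<open>v\<close> and, by convexity, the infimum of continuous functions, namely of half the
  forward difference quotients of \<open>T\<close>. An upper semicontinuous function is discontinuous only
  on the boundaries of its sublevel sets at rational levels, which are nowhere dense.

  For \<open>I\<^sub>v\<close>, normalise null directions by \<open>\<langle>n, v\<rangle> = -1\<close>; then \<open>I\<^sub>v(x)\<close> is the largest \<open>a\<close> for which
  the ray from \<open>q - a n\<close> along some such \<open>n\<close> lies in the boundary, and the space of such \<open>n\<close> is
  compact.\<close>


section \<open>The Minkowski form\<close>

lemma three_eq_zero: "(3::3) = 0"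
  by simp

lemma vec3_eq_iff: "x = y \<longleftrightarrow> x $ 0 = y $ 0 \<and> x $ 1 = y $ 1 \<and> x $ 2 = y $ 2" for x y :: "'a^3"
  unfolding vec_eq_iff forall_3 three_eq_zero by auto

lemma mink_commute: "mink x y = mink y x"
  by (simp add: mink_def algebra_simps)

lemma mink_algebra:
  "mink (x + y) z = mink x z + mink y z" "mink z (x + y) = mink z x + mink z y"
  "mink (x - y) z = mink x z - mink y z" "mink z (x - y) = mink z x - mink z y"
  "mink (k *\<^sub>R x) z = k * mink x z" "mink z (k *\<^sub>R x) = k * mink z x"
  "mink (- x) z = - mink x z" "mink z (- x) = - mink z x"
  "mink 0 z = 0" "mink z 0 = 0"
  by (simp_all add: mink_def algebra_simps)

lemma mink_self_add: "mink (x + y) (x + y) = mink x x + 2 * mink x y + mink y y"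
  and mink_self_diff: "mink (x - y) (x - y) = mink x x - 2 * mink x y + mink y y"
  and mink_self_scaleR: "mink (k *\<^sub>R x) (k *\<^sub>R x) = k\<^sup>2 * mink x x"
  by (simp_all add: mink_algebra mink_commute[of y x] power2_eq_square)

lemma tendsto_mink [tendsto_intros]:
  "(f \<longlongrightarrow> a) F \<Longrightarrow> (g \<longlongrightarrow> b) F \<Longrightarrow> ((\<lambda>t. mink (f t) (g t)) \<longlongrightarrow> mink a b) F"
  unfolding mink_def by (intro tendsto_intros)

lemma continuous_on_mink [continuous_intros]:
  "continuous_on S f \<Longrightarrow> continuous_on S g \<Longrightarrow> continuous_on S (\<lambda>t. mink (f t) (g t))"
  unfolding mink_def by (intro continuous_intros)

lemma bounded_linear_mink: "bounded_linear (\<lambda>w. mink w n)"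
  by (simp add: linear_conv_bounded_linear[symmetric] linear_iff mink_algebra)

section \<open>Cauchy-Schwarz inequalities, Euclidean and reversed\<close>

lemma cauchy_schwarz_2:
  fixes a b c d :: real
  shows "(a * c + b * d)\<^sup>2 \<le> (a\<^sup>2 + b\<^sup>2) * (c\<^sup>2 + d\<^sup>2)"
proof -
  have "(a\<^sup>2 + b\<^sup>2) * (c\<^sup>2 + d\<^sup>2) - (a * c + b * d)\<^sup>2 = (a * d - b * c)\<^sup>2"
    by (simp add: power2_eq_square algebra_simps)
  then show ?thesis
    using zero_le_power2[of "a * d - b * c"] by linarith
qed

lemma mink_self: "mink x x = (x $ 1)\<^sup>2 + (x $ 2)\<^sup>2 - (x $ 0)\<^sup>2"
  by (simp add: mink_def power2_eq_square)

lemma mink_self_eq_0_time_0: "mink x x \<le> 0 \<Longrightarrow> x $ 0 = 0 \<Longrightarrow> x = 0"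
  using sum_power2_le_zero_iff[of "x $ 1" "x $ 2"] by (simp add: mink_self vec3_eq_iff)

text \<open>Orthogonality to \<open>a\<close> expresses \<open>a $ 0 * w $ 0\<close> as a spatial
  inner product. Since the time part of \<open>a\<close> strictly dominates its spatial part,
  Cauchy-Schwarz forces the spatial part of \<open>w\<close> to dominate its time part.\<close>

lemma timelike_perp:
  assumes a: "mink a a < 0" and w: "mink a w = 0"
  shows "mink w w \<ge> 0" and "mink w w = 0 \<Longrightarrow> w = 0"
proof -
  define A where "A = (a $ 1)\<^sup>2 + (a $ 2)\<^sup>2"
  define S where "S = (w $ 1)\<^sup>2 + (w $ 2)\<^sup>2"
  have S0: "S \<ge> 0" and A0: "A \<ge> 0"
    by (simp_all add: S_def A_def)
  have A: "A < (a $ 0)\<^sup>2"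
    using a by (simp add: A_def mink_self)
  have "a $ 0 * w $ 0 = a $ 1 * w $ 1 + a $ 2 * w $ 2"
    using w by (simp add: mink_def)
  then have "(a $ 0 * w $ 0)\<^sup>2 \<le> A * S"
    using cauchy_schwarz_2 by (simp add: A_def S_def)
  then have *: "(a $ 0)\<^sup>2 * (w $ 0)\<^sup>2 \<le> A * S"
    by (simp add: power_mult_distrib)
  have AS: "A * S \<le> (a $ 0)\<^sup>2 * S"
    using A S0 by (intro mult_right_mono) auto
  have pos: "(a $ 0)\<^sup>2 > 0"
    using A A0 by linarith
  have "(a $ 0)\<^sup>2 * (w $ 0)\<^sup>2 \<le> (a $ 0)\<^sup>2 * S"
    using * AS by linarith
  then have "(w $ 0)\<^sup>2 \<le> S"
    using pos by simp
  then show "mink w w \<ge> 0"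
    by (simp add: mink_self S_def)
  assume "mink w w = 0"
  then have eq: "(w $ 0)\<^sup>2 = S"
    by (simp add: mink_self S_def)
  have "S \<le> 0"
  proof (rule ccontr)
    assume "\<not> S \<le> 0"
    then have "A * S < (a $ 0)\<^sup>2 * S"
      using A by simp
    then show False
      using * eq by simp
  qed
  then have "S = 0" using S0 by simp
  then show "w = 0"
    using eq \<open>mink w w = 0\<close> by (intro mink_self_eq_0_time_0) auto
qed

text \<open>The component of \<open>b\<close> orthogonal to \<open>a\<close> has nonnegative square
  by \<open>timelike_perp\<close>; multiplying by the negative number \<open>mink a a\<close>
  reverses the inequality. The vector \<open>b\<close> is arbitrary here.\<close>

lemma reverse_cauchy_schwarz:
  assumes a: "mink a a < 0"
  shows "mink a a * mink b b \<le> (mink a b)\<^sup>2"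
proof -
  define k where "k = mink a b / mink a a"
  have k: "k * mink a a = mink a b"
    using a by (simp add: k_def)
  have "mink a (b - k *\<^sub>R a) = 0"
    using k by (simp add: mink_algebra)
  then have "mink (b - k *\<^sub>R a) (b - k *\<^sub>R a) \<ge> 0"
    using timelike_perp(1)[OF a] by blast
  then have "mink b b \<ge> k * mink a b"
    using k by (simp add: mink_algebra mink_commute[of b a] algebra_simps)
  then have "mink a a * mink b b \<le> mink a a * (k * mink a b)"
    using a by (intro mult_left_mono_neg) auto
  also have "\<dots> = (mink a b)\<^sup>2"
    by (simp add: k[symmetric] power2_eq_square)
  finally show ?thesis .
qed

section \<open>Future timelike, causal and lightlike vectors\<close>

lemma future_timelike_imp_causal: "future_timelike a \<Longrightarrow> future_causal a"
  by (simp add: future_timelike_def future_causal_def)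

lemma future_causal_nonpos:
  assumes "future_causal a" "future_causal b"
  shows "mink a b \<le> 0"
proof (rule ccontr)
  assume "\<not> mink a b \<le> 0"
  then have *: "a $ 0 * b $ 0 < a $ 1 * b $ 1 + a $ 2 * b $ 2"
    by (simp add: mink_def)
  have pos: "a $ 0 * b $ 0 > 0"
    using assms by (simp add: future_causal_def)
  have "(a $ 0 * b $ 0)\<^sup>2 < (a $ 1 * b $ 1 + a $ 2 * b $ 2)\<^sup>2"
    using * pos by (intro power_strict_mono) auto
  also have "\<dots> \<le> ((a $ 1)\<^sup>2 + (a $ 2)\<^sup>2) * ((b $ 1)\<^sup>2 + (b $ 2)\<^sup>2)"
    by (rule cauchy_schwarz_2)
  also have "\<dots> \<le> (a $ 0)\<^sup>2 * (b $ 0)\<^sup>2"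
    using assms by (intro mult_mono) (auto simp: future_causal_def mink_self)
  finally show False
    by (simp add: power_mult_distrib)
qed

lemma future_timelike_causal_neg:
  assumes "future_timelike a" "future_causal b"
  shows "mink a b < 0"
proof -
  have "mink a b \<noteq> 0"
  proof
    assume *: "mink a b = 0"
    have a: "mink a a < 0"
      using assms by (simp add: future_timelike_def)
    have "mink b b = 0"
      using timelike_perp(1)[OF a *] assms(2) by (simp add: future_causal_def)
    then show False
      using timelike_perp(2)[OF a *] assms(2) by (simp add: future_causal_def)
  qed
  then show ?thesis
    using future_causal_nonpos[OF future_timelike_imp_causal[OF assms(1)] assms(2)] by simp
qed

lemma future_timelike_scaleR: "future_timelike a \<Longrightarrow> k > 0 \<Longrightarrow> future_timelike (k *\<^sub>R a)"
  by (simp add: future_timelike_def mink_algebra mult_pos_neg)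

lemma future_causal_scaleR: "future_causal a \<Longrightarrow> k > 0 \<Longrightarrow> future_causal (k *\<^sub>R a)"
  by (simp add: future_causal_def mink_algebra mult_nonneg_nonpos)

lemma lightlike_future_causal: "lightlike n \<Longrightarrow> n $ 0 > 0 \<Longrightarrow> future_causal n"
  by (simp add: future_causal_def lightlike_def)

lemma lightlike_time_nonzero: "lightlike n \<Longrightarrow> n $ 0 \<noteq> 0"
  using mink_self_eq_0_time_0[of n] by (auto simp: lightlike_def)

lemma lightlike_scaleR: "lightlike n \<Longrightarrow> k \<noteq> 0 \<Longrightarrow> lightlike (k *\<^sub>R n)"
  by (simp add: lightlike_def mink_algebra)

text \<open>If \<open>mink m n\<close> vanished, the combination of \<open>m\<close> and
  \<open>n\<close> with zero time coordinate would have square zero, hence be zero, and the vectors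
  would be proportional. So \<open>mink m n < 0\<close>, and this is half the square of the
  sum.\<close>

lemma lightlike_not_proportional_add:
  assumes m: "lightlike m" "m $ 0 > 0" and n: "lightlike n" "n $ 0 > 0"
    and np: "\<And>k. m \<noteq> k *\<^sub>R n"
  shows "future_timelike (m + n)"
proof -
  have le: "mink m n \<le> 0"
    using m n by (intro future_causal_nonpos lightlike_future_causal)
  have "mink m n \<noteq> 0"
  proof
    assume 0: "mink m n = 0"
    have "n $ 0 *\<^sub>R m - m $ 0 *\<^sub>R n = 0"
      using m n 0 by (intro mink_self_eq_0_time_0)
        (auto simp: mink_algebra mink_commute[of n m] lightlike_def)
    then have "m = (m $ 0 / n $ 0) *\<^sub>R n"
      using n(2) by (simp add: vec3_eq_iff field_simps)
    with np show False by blast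
  qed
  with le m n show ?thesis
    by (simp add: future_timelike_def lightlike_def mink_algebra mink_commute[of n m])
qed

lemma open_future_timelike: "open {w. future_timelike w}"
proof -
  have "{w. future_timelike w} = {w. mink w w < 0} \<inter> {w. 0 < w $ 0}"
    by (auto simp: future_timelike_def)
  also have "open \<dots>"
    by (intro open_Int open_Collect_less continuous_intros)
  finally show ?thesis .
qed

lemma eventually_future_timelike:
  assumes "(f \<longlongrightarrow> a) F" "future_timelike a"
  shows "\<forall>\<^sub>F t in F. future_timelike (f t)"
  using topological_tendstoD[OF assms(1) open_future_timelike] assms(2) by simp

text \<open>On the closed future cone a timelike functional controls the Euclidean norm, because
  \<open>v $ 0\<close> exceeds the spatial norm of \<open>v\<close>. This yields compactness both of
  causal pasts inside \<open>closure D\<close> and of the normalised null directions.\<close>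

lemma causal_norm_bound:
  assumes "future_timelike v"
  obtains B where "B > 0"
    "\<And>w. mink w w \<le> 0 \<Longrightarrow> w $ 0 \<ge> 0 \<Longrightarrow> norm w \<le> B * (- mink w v)"
proof -
  define \<rho> where "\<rho> = sqrt ((v $ 1)\<^sup>2 + (v $ 2)\<^sup>2)"
  have "(v $ 1)\<^sup>2 + (v $ 2)\<^sup>2 < (v $ 0)\<^sup>2" "v $ 0 > 0"
    using assms by (auto simp: future_timelike_def mink_self)
  then have \<rho>: "\<rho> < v $ 0"
    unfolding \<rho>_def by (intro real_less_lsqrt) auto
  have bound: "norm w \<le> 3 / (v $ 0 - \<rho>) * (- mink w v)" if w: "mink w w \<le> 0" "w $ 0 \<ge> 0" for w
  proof -
    have sq: "(w $ 1)\<^sup>2 + (w $ 2)\<^sup>2 \<le> (w $ 0)\<^sup>2"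
      using w by (simp add: mink_self)
    have "\<bar>w $ 1\<bar>\<^sup>2 \<le> (w $ 0)\<^sup>2" "\<bar>w $ 2\<bar>\<^sup>2 \<le> (w $ 0)\<^sup>2"
      unfolding power2_abs using sq zero_le_power2[of "w $ 1"] zero_le_power2[of "w $ 2"]
      by linarith+
    then have "\<bar>w $ 1\<bar> \<le> w $ 0" "\<bar>w $ 2\<bar> \<le> w $ 0"
      using w(2) by (blast intro: power2_le_imp_le)+
    moreover have "norm w \<le> \<bar>w $ 1\<bar> + \<bar>w $ 2\<bar> + \<bar>w $ 0\<bar>"
      using norm_le_l1_cart[of w] unfolding sum_3 three_eq_zero .
    ultimately have 1: "norm w \<le> 3 * w $ 0"
      by linarith
    have "(w $ 1 * v $ 1 + w $ 2 * v $ 2)\<^sup>2 \<le> ((w $ 1)\<^sup>2 + (w $ 2)\<^sup>2) * ((v $ 1)\<^sup>2 + (v $ 2)\<^sup>2)"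
      by (rule cauchy_schwarz_2)
    also have "\<dots> \<le> (w $ 0)\<^sup>2 * \<rho>\<^sup>2"
      using sq by (intro mult_mono) (auto simp: \<rho>_def)
    finally have "(w $ 1 * v $ 1 + w $ 2 * v $ 2)\<^sup>2 \<le> (w $ 0 * \<rho>)\<^sup>2"
      by (simp add: power_mult_distrib)
    moreover have "0 \<le> w $ 0 * \<rho>"
      using w(2) by (simp add: \<rho>_def)
    ultimately have "w $ 1 * v $ 1 + w $ 2 * v $ 2 \<le> w $ 0 * \<rho>"
      by (rule power2_le_imp_le)
    then have "w $ 0 * (v $ 0 - \<rho>) \<le> - mink w v"
      by (simp add: mink_def algebra_simps)
    then have "w $ 0 \<le> - mink w v / (v $ 0 - \<rho>)"
      using \<rho> by (simp add: field_simps)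
    with 1 show ?thesis
      by simp
  qed
  show thesis
    by (rule that[of "3 / (v $ 0 - \<rho>)"]) (use \<rho> bound in auto)
qed

text \<open>A linear bound for the length element; integrating it along a curve leaves only the
  endpoints.\<close>

lemma sqrt_mink_le:
  assumes "future_causal w" "future_timelike n" "mink n n = -1"
  shows "sqrt (- mink w w) \<le> - mink w n"
proof -
  have "- mink w w \<le> (mink w n)\<^sup>2"
    using reverse_cauchy_schwarz[of n w] assms by (simp add: mink_commute[of n w])
  moreover have "mink w n \<le> 0"
    using assms future_causal_nonpos future_timelike_imp_causal by blast
  ultimately show ?thesis
    by (intro real_le_lsqrt) auto
qed

lemma eventually_at_right_0_witness:
  assumes "\<forall>\<^sub>F h in at_right (0::real). P h"
  obtains h where "h > 0" "P h"
proof -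
  obtain b where "b > 0" "\<forall>y>0. y < b \<longrightarrow> P y"
    using assms by (auto simp: eventually_at_right_field)
  then show thesis
    using that[of "b / 2"] by simp
qed

section \<open>Lightlike planes and domains of dependence\<close>

text \<open>Its product with \<open>n\<close> is \<open>- n $ 0\<close>, so moving along it brings a
  point to any prescribed level of a lightlike functional.\<close>

definition time_axis :: "real^3" where
  "time_axis = axis 0 1"

lemma mink_time_axis: "mink time_axis n = - n $ 0" "mink n time_axis = - n $ 0"
  by (auto simp: time_axis_def mink_def axis_def)

lemma future_timelike_time_axis: "future_timelike time_axis"
  by (auto simp: time_axis_def future_timelike_def mink_def axis_def)

lemma lightlike_planeE:
  assumes "lightlike_plane P"
  obtains n c where "lightlike n" "n $ 0 > 0" "P = {x. mink x n = c}"
proof -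
  obtain n c where n: "lightlike n" and P: "P = {x. mink x n = c}"
    using assms by (auto simp: lightlike_plane_def)
  show thesis
  proof (cases "n $ 0 > 0")
    case True
    with n P that show thesis by blast
  next
    case False
    then have "n $ 0 < 0"
      using lightlike_time_nonzero[OF n] by simp
    moreover have "lightlike (- n)"
      using n by (simp add: lightlike_def mink_algebra)
    moreover have "P = {x. mink x (- n) = - c}"
      by (simp add: P mink_algebra)
    ultimately show thesis
      by (intro that[of "- n" "- c"]) auto
  qed
qed

text \<open>Turns the futures in the definition of a domain of dependence into open half-spaces. For
  the converse inclusion the point is dropped vertically onto the plane.\<close>

lemma future_of_lightlike_plane:
  assumes "lightlike n" "n $ 0 > 0"
  shows "future_of {x. mink x n = c} = {y. mink y n < c}"
proof (intro set_eqI iffI)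
  fix y assume "y \<in> future_of {x. mink x n = c}"
  then obtain x where "mink x n = c" "future_timelike (y - x)"
    by (auto simp: future_of_def)
  then show "y \<in> {y. mink y n < c}"
    using future_timelike_causal_neg[of "y - x" n] lightlike_future_causal[OF assms]
    by (simp add: mink_algebra)
next
  fix y assume y: "y \<in> {y. mink y n < c}"
  define s where "s = (c - mink y n) / n $ 0"
  have "s > 0"
    using y assms by (simp add: s_def)
  then have "future_timelike (y - (y - s *\<^sub>R time_axis))"
    by (simp add: future_timelike_scaleR future_timelike_time_axis)
  moreover have "mink (y - s *\<^sub>R time_axis) n = c"
    using assms by (simp add: mink_algebra mink_time_axis s_def)
  ultimately show "y \<in> future_of {x. mink x n = c}"
    unfolding future_of_def by blast
qed

lemma parallel_lightlike_planes:
  assumes "lightlike n" "k \<noteq> 0"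
  shows "parallel {x. mink x n = c} {x. mink x (k *\<^sub>R n) = d}"
proof -
  have n0: "n $ 0 \<noteq> 0"
    using assms lightlike_time_nonzero by blast
  define a where "a = (- (d / k - c) / n $ 0) *\<^sub>R time_axis"
  have a: "mink a n = d / k - c"
    using n0 by (simp add: a_def mink_algebra mink_time_axis)
  have "y \<in> (+) a ` {x. mink x n = c}" if "mink y (k *\<^sub>R n) = d" for y
    using that assms(2) a
    by (intro image_eqI[of _ _ "y - a"]) (auto simp: mink_algebra nonzero_divide_eq_eq)
  moreover have "mink (a + x) (k *\<^sub>R n) = d" if "mink x n = c" for x
    using that assms(2) a by (auto simp: mink_algebra field_simps)
  ultimately show ?thesis
    unfolding parallel_def by (intro exI[of _ a]) auto
qed


section \<open>Supporting half-spaces and invariance under future translations\<close>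

locale dependence_domain =
  fixes D :: "(real^3) set"
  assumes dod: "domain_of_dependence D"
begin

lemma D_nonempty: "D \<noteq> {}" and D_open: "open D" and D_convex: "convex D"
  using dod by (auto simp: domain_of_dependence_def)

text \<open>A point outside an intersection is missed by one of its members, which here is a
  half-space with null normal.\<close>

lemma null_support_outside:
  assumes "q \<notin> D"
  obtains n c where "lightlike n" "n $ 0 > 0" "c \<le> mink q n" "\<And>y. y \<in> D \<Longrightarrow> mink y n < c"
proof -
  obtain \<F> where \<F>: "\<forall>P\<in>\<F>. lightlike_plane P" "D = (\<Inter>P\<in>\<F>. future_of P)"
    using dod by (auto simp: domain_of_dependence_def)
  then obtain P where P: "P \<in> \<F>" "q \<notin> future_of P"
    using assms by auto
  obtain n c where n: "lightlike n" "n $ 0 > 0" and Pn: "P = {x. mink x n = c}"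
    using lightlike_planeE \<F>(1) P(1) by blast
  have "future_of P = {y. mink y n < c}"
    unfolding Pn using n by (rule future_of_lightlike_plane)
  with P \<F>(2) n that[of n c] show thesis
    by (auto simp: not_less)
qed

lemma null_support_closure:
  assumes "q \<notin> D"
  obtains n c where "lightlike n" "n $ 0 > 0" "c \<le> mink q n"
    "\<And>y. y \<in> closure D \<Longrightarrow> mink y n \<le> c"
proof -
  obtain n c where n: "lightlike n" "n $ 0 > 0" "c \<le> mink q n"
    and D: "\<And>y. y \<in> D \<Longrightarrow> mink y n < c"
    using null_support_outside[OF assms] by metis
  have "closure D \<subseteq> {y. mink y n \<le> c}"
  proof (rule closure_minimal)
    show "D \<subseteq> {y. mink y n \<le> c}"
      using D less_imp_le by blast
    show "closed {y. mink y n \<le> c}"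
      by (intro closed_Collect_le continuous_intros)
  qed
  with n that show thesis by blast
qed

lemma D_future:
  assumes "p \<in> D" "future_causal w"
  shows "p + w \<in> D"
proof (rule ccontr)
  assume "p + w \<notin> D"
  then obtain n c where n: "lightlike n" "n $ 0 > 0" "c \<le> mink (p + w) n"
    and D: "\<And>y. y \<in> D \<Longrightarrow> mink y n < c"
    using null_support_outside by metis
  have "mink w n \<le> 0"
    using assms n by (intro future_causal_nonpos) (auto intro: lightlike_future_causal)
  with n(3) D[OF assms(1)] show False
    by (simp add: mink_algebra)
qed

text \<open>On the closure the supporting inequality is only weak, but a timelike \<open>w\<close>
  has strictly negative product with the null normal, which restores strictness.\<close>

lemma closure_timelike_future:
  assumes "p \<in> closure D" "future_timelike w"
  shows "p + w \<in> D"
proof (rule ccontr)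
  assume "p + w \<notin> D"
  then obtain n c where n: "lightlike n" "n $ 0 > 0" "c \<le> mink (p + w) n"
    and D: "\<And>y. y \<in> closure D \<Longrightarrow> mink y n \<le> c"
    using null_support_closure by metis
  have "mink w n < 0"
    using assms n by (intro future_timelike_causal_neg lightlike_future_causal)
  with n(3) D[OF assms(1)] show False
    by (simp add: mink_algebra)
qed

lemma closure_future:
  assumes "p \<in> closure D" "future_causal w"
  shows "p + w \<in> closure D"
proof -
  have "(+) w ` closure D = closure ((+) w ` D)"
    by (rule closure_translation[symmetric])
  also have "\<dots> \<subseteq> closure D"
    using D_future[OF _ assms(2)] by (intro closure_mono) (auto simp: add.commute)
  finally show ?thesis
    using assms(1) by (auto simp: add.commute)
qed

text \<open>A point of \<open>D\<close> on the past side of the plane could be moved vertically onto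
  the plane without leaving \<open>D\<close>.\<close>

lemma disjoint_plane_bound:
  assumes n: "lightlike n" "n $ 0 > 0" and disj: "{x. mink x n = c} \<subseteq> - D" and y: "y \<in> D"
  shows "mink y n \<le> c"
proof (rule ccontr)
  assume "\<not> mink y n \<le> c"
  then have s: "(mink y n - c) / n $ 0 > 0"
    using n by simp
  have "y + ((mink y n - c) / n $ 0) *\<^sub>R time_axis \<in> D"
    by (intro D_future y future_timelike_imp_causal future_timelike_scaleR
        future_timelike_time_axis s)
  moreover have "mink (y + ((mink y n - c) / n $ 0) *\<^sub>R time_axis) n = c"
    using n by (simp add: mink_algebra mink_time_axis)
  ultimately show False
    using disj by blast
qed

text \<open>Non-parallel planes have non-proportional null normals, whose sum is timelike, and the
  two half-space bounds add up. This bounds \<open>closure D\<close> towards the past.\<close>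

lemma timelike_bound:
  obtains m c where "future_timelike m" "\<And>y. y \<in> closure D \<Longrightarrow> mink y m \<le> c"
proof -
  obtain P Q where PQ: "lightlike_plane P" "lightlike_plane Q" "\<not> parallel P Q"
    "P \<subseteq> - D" "Q \<subseteq> - D"
    using dod by (auto simp: domain_of_dependence_def)
  obtain n c where n: "lightlike n" "n $ 0 > 0" and P: "P = {x. mink x n = c}"
    using lightlike_planeE PQ(1) by blast
  obtain n' c' where n': "lightlike n'" "n' $ 0 > 0" and Q: "Q = {x. mink x n' = c'}"
    using lightlike_planeE PQ(2) by blast
  have "n' \<noteq> k *\<^sub>R n" for k
  proof
    assume k: "n' = k *\<^sub>R n"
    then have "k \<noteq> 0"
      using n' by (auto simp: lightlike_def)
    then show False
      using parallel_lightlike_planes[OF n(1), of k c c'] PQ(3) unfolding P Q k by blast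
  qed
  then have "future_timelike (n' + n)"
    by (intro lightlike_not_proportional_add n n')
  moreover have "closure D \<subseteq> {y. mink y (n' + n) \<le> c' + c}"
  proof (rule closure_minimal)
    show "D \<subseteq> {y. mink y (n' + n) \<le> c' + c}"
      using disjoint_plane_bound[OF n, of c] disjoint_plane_bound[OF n', of c'] PQ(4,5)
      unfolding P Q by (force simp: mink_algebra)
    show "closed {y. mink y (n' + n) \<le> c' + c}"
      by (intro closed_Collect_le continuous_intros)
  qed
  ultimately show thesis
    using that by blast
qed

section \<open>Retraction to the boundary\<close>

text \<open>The causal past of \<open>p\<close> in \<open>closure D\<close> is compact, so some
  \<open>r\<close> in it maximises \<open>- mink (p - r) (p - r)\<close>. The support inequality is
  the first-order condition for moving \<open>r\<close> towards \<open>q\<close>, which convexity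
  permits.\<close>

lemma ex_retraction:
  assumes p: "p \<in> D"
  shows "\<exists>r\<in>closure D. future_timelike (p - r) \<and> (\<forall>q\<in>closure D. mink (q - r) (p - r) \<le> 0)"
proof -
  define K where "K = closure D \<inter> {q. mink (p - q) (p - q) \<le> 0} \<inter> {q. 0 \<le> (p - q) $ 0}"
  obtain m c where m: "future_timelike m" "\<And>y. y \<in> closure D \<Longrightarrow> mink y m \<le> c"
    using timelike_bound by blast
  obtain B where B: "B > 0" "\<And>w. mink w w \<le> 0 \<Longrightarrow> w $ 0 \<ge> 0 \<Longrightarrow> norm w \<le> B * (- mink w m)"
    using causal_norm_bound[OF m(1)] by blast
  have "closed K"
    unfolding K_def by (intro closed_Int closed_closure closed_Collect_le continuous_intros)
  moreover have "bounded K"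
  proof (rule boundedI)
    fix q assume q: "q \<in> K"
    then have "norm (p - q) \<le> B * (- mink (p - q) m)"
      using B(2)[of "p - q"] by (simp add: K_def)
    also have "\<dots> \<le> B * (c - mink p m)"
      using B(1) m(2)[of q] q by (auto simp: K_def mink_algebra)
    finally have "norm (p - q) \<le> B * (c - mink p m)" .
    then show "norm q \<le> norm p + B * (c - mink p m)"
      using norm_triangle_ineq4[of p "p - q"] by simp
  qed
  ultimately have "compact K"
    by (simp add: compact_eq_bounded_closed)
  have pK: "p \<in> K"
    using p closure_subset by (auto simp: K_def mink_algebra)
  have "continuous_on K (\<lambda>q. - mink (p - q) (p - q))"
    by (intro continuous_intros)
  then obtain r where r: "r \<in> K"
    and max: "\<And>q. q \<in> K \<Longrightarrow> - mink (p - q) (p - q) \<le> - mink (p - r) (p - r)"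
    using continuous_attains_sup[OF \<open>compact K\<close>, of "\<lambda>q. - mink (p - q) (p - q)"] pK by blast
  have "\<forall>\<^sub>F h in at_right (0::real). p - h *\<^sub>R time_axis \<in> D"
  proof (rule topological_tendstoD[OF _ D_open])
    show "((\<lambda>h. p - h *\<^sub>R time_axis) \<longlongrightarrow> p) (at_right 0)"
      by (auto intro!: tendsto_eq_intros)
  qed (fact p)
  \<comment> \<open>A point of \<open>D\<close> slightly below \<open>p\<close> makes the maximum
    positive, so \<open>p - r\<close> is timelike and not merely causal.\<close>
  then obtain h :: real where h: "h > 0" "p - h *\<^sub>R time_axis \<in> D"
    by (rule eventually_at_right_0_witness)
  have ht: "future_timelike (p - (p - h *\<^sub>R time_axis))"
    using h by (simp add: future_timelike_scaleR future_timelike_time_axis)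
  then have "p - h *\<^sub>R time_axis \<in> K"
    using h(2) closure_subset[of D] by (auto simp: K_def future_timelike_def)
  then have T: "mink (p - r) (p - r) < 0"
    using max[of "p - h *\<^sub>R time_axis"] ht by (simp add: future_timelike_def)
  then have a: "future_timelike (p - r)"
    using r mink_self_eq_0_time_0[of "p - r"]
    by (auto simp: K_def future_timelike_def less_le mink_algebra)
  \<comment> \<open>Maximality against \<open>r + s (q - r)\<close> gives twice this product at most
    \<open>s * mink (q - r) (q - r)\<close>; then \<open>s\<close> tends to
    \<open>0\<close>.\<close>
  have "mink (q - r) (p - r) \<le> 0" if q: "q \<in> closure D" for q
  proof (rule tendsto_lowerbound)
    show "((\<lambda>s. s * mink (q - r) (q - r) / 2) \<longlongrightarrow> 0) (at_right 0)"
      by (auto intro!: tendsto_eq_intros)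
    have "((\<lambda>s. (p - r) - s *\<^sub>R (q - r)) \<longlongrightarrow> p - r) (at_right 0)"
      by (auto intro!: tendsto_eq_intros)
    then have "\<forall>\<^sub>F s in at_right 0. future_timelike ((p - r) - s *\<^sub>R (q - r))"
      using a by (rule eventually_future_timelike)
    moreover have "\<forall>\<^sub>F s in at_right (0::real). s < 1"
      by (rule eventually_at_rightI[of 0 1]) auto
    moreover have "\<forall>\<^sub>F s in at_right (0::real). 0 < s"
      by (rule eventually_at_right_less)
    ultimately show "\<forall>\<^sub>F s in at_right 0. mink (q - r) (p - r) \<le> s * mink (q - r) (q - r) / 2"
    proof eventually_elim
      case (elim s)
      have "(1 - s) *\<^sub>R r + s *\<^sub>R q \<in> closure D"
        using r q elim by (intro convexD[OF convex_closure[OF D_convex]]) (auto simp: K_def)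
      moreover have eq: "p - ((1 - s) *\<^sub>R r + s *\<^sub>R q) = (p - r) - s *\<^sub>R (q - r)"
        by (simp add: algebra_simps)
      ultimately have "(1 - s) *\<^sub>R r + s *\<^sub>R q \<in> K"
        using elim(1) unfolding K_def future_timelike_def Int_iff mem_Collect_eq eq by simp
      then have "- mink ((p - r) - s *\<^sub>R (q - r)) ((p - r) - s *\<^sub>R (q - r)) \<le> - mink (p - r) (p - r)"
        using max unfolding eq[symmetric] by blast
      then have "s * (2 * mink (q - r) (p - r)) \<le> s * (s * mink (q - r) (q - r))"
        unfolding mink_self_diff[of "p - r"] mink_self_scaleR
        by (simp only: mink_algebra(5,6) mink_commute[of "p - r" "q - r"] power2_eq_square)
      then show ?case
        using elim by simp
    qed
  qed simp
  moreover have "r \<in> closure D"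
    using r by (simp add: K_def)
  ultimately show ?thesis
    using a by blast
qed

text \<open>The choice is by the support inequality and not by maximality of the distance, since the
  bounds on \<open>sqtime\<close> start from the former.\<close>

definition retr :: "real^3 \<Rightarrow> real^3" where
  "retr p = (SOME r. r \<in> closure D \<and> future_timelike (p - r) \<and>
                     (\<forall>q\<in>closure D. mink (q - r) (p - r) \<le> 0))"

text \<open>The square of the cosmological time, by \<open>cosmological_time_eq\<close>; squaring
  makes the comparison functions polynomial in the point.\<close>

definition sqtime :: "real^3 \<Rightarrow> real" where
  "sqtime p = - mink (p - retr p) (p - retr p)"

lemma
  assumes p: "p \<in> D"
  shows retr_closure: "retr p \<in> closure D"
    and retr_timelike: "future_timelike (p - retr p)"
    and retr_support: "q \<in> closure D \<Longrightarrow> mink (q - retr p) (p - retr p) \<le> 0"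
proof -
  have "retr p \<in> closure D \<and> future_timelike (p - retr p) \<and>
      (\<forall>q\<in>closure D. mink (q - retr p) (p - retr p) \<le> 0)"
    unfolding retr_def by (rule someI_ex) (use ex_retraction[OF p] in blast)
  then show "retr p \<in> closure D" "future_timelike (p - retr p)"
    "q \<in> closure D \<Longrightarrow> mink (q - retr p) (p - retr p) \<le> 0"
    by blast+
qed

lemma sqtime_pos: "p \<in> D \<Longrightarrow> sqtime p > 0"
  using retr_timelike by (auto simp: sqtime_def future_timelike_def)

text \<open>From a point of the open set \<open>D\<close> one could step a little further away from
  \<open>p\<close>, crossing the support plane.\<close>

lemma retr_notin:
  assumes p: "p \<in> D"
  shows "retr p \<notin> D"
proof
  assume *: "retr p \<in> D"
  have "\<forall>\<^sub>F h in at_right (0::real). retr p - h *\<^sub>R (p - retr p) \<in> D"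
    by (rule topological_tendstoD[OF _ D_open *]) (auto intro!: tendsto_eq_intros)
  then obtain h :: real where h: "h > 0" "retr p - h *\<^sub>R (p - retr p) \<in> D"
    by (rule eventually_at_right_0_witness)
  have "mink (retr p - h *\<^sub>R (p - retr p) - retr p) (p - retr p) \<le> 0"
    using h(2) closure_subset by (intro retr_support p) blast
  then have "h * sqtime p \<le> 0"
    by (simp add: mink_algebra sqtime_def algebra_simps)
  then show False
    using h(1) sqtime_pos[OF p] by (simp add: mult_le_0_iff)
qed

text \<open>This recovers maximality of the distance. Support at \<open>retr p'\<close> bounds the
  product of \<open>a\<close> and \<open>b\<close> below by \<open>- sqtime p'\<close>, and reverse
  Cauchy-Schwarz converts this into a bound on \<open>- mink b b\<close>.\<close>

lemma sqtime_lower: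
  assumes p: "p \<in> D" and p': "p' \<in> D"
  shows "- mink (p' - retr p) (p' - retr p) \<le> sqtime p'"
proof -
  define a where "a = p' - retr p'"
  define b where "b = p' - retr p"
  have aa: "mink a a = - sqtime p'"
    by (simp add: a_def sqtime_def)
  have "mink (retr p - retr p') a \<le> 0"
    unfolding a_def by (intro retr_support p' retr_closure p)
  moreover have "b = a - (retr p - retr p')"
    by (simp add: a_def b_def)
  ultimately have ge: "mink a b \<ge> - sqtime p'"
    using aa by (simp add: mink_algebra mink_commute)
  have a: "future_timelike a"
    unfolding a_def by (rule retr_timelike[OF p'])
  have "- mink b b \<le> sqtime p'"
  proof (cases "mink b b < 0")
    case True
    then have b0: "b $ 0 \<noteq> 0"
      using mink_self_eq_0_time_0[of b] by (auto simp: mink_algebra)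
    \<comment> \<open>A past-directed \<open>b\<close> would put \<open>retr p\<close> in the future
      of \<open>p'\<close>, hence in \<open>D\<close>.\<close>
    have "b $ 0 > 0"
    proof (rule ccontr)
      assume "\<not> b $ 0 > 0"
      then have "future_timelike (- b)"
        using True b0 by (simp add: future_timelike_def mink_algebra)
      then have "p' + (- b) \<in> D"
        by (intro D_future[OF p'] future_timelike_imp_causal)
      then show False
        using retr_notin[OF p] by (simp add: b_def)
    qed
    then have "mink a b \<le> 0"
      using True a by (intro future_causal_nonpos) (auto simp: future_timelike_def future_causal_def)
    then have "(mink a b)\<^sup>2 \<le> (sqtime p')\<^sup>2"
      using ge by (intro power2_le_iff_abs_le[THEN iffD2]) (auto simp: sqtime_pos[OF p', THEN less_imp_le])
    with reverse_cauchy_schwarz[of a b] a have "sqtime p' * (- mink b b) \<le> sqtime p' * sqtime p'"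
      by (simp add: aa future_timelike_def power2_eq_square)
    then show ?thesis
      using sqtime_pos[OF p'] by (simp only: mult_le_cancel_left_pos)
  next
    case False
    then show ?thesis
      using sqtime_pos[OF p'] by simp
  qed
  then show ?thesis
    by (simp add: b_def)
qed

text \<open>The point \<open>retr p'\<close> lies on the supported side of the plane at
  \<open>retr p\<close>, so replacing it by \<open>retr p\<close> can only enlarge the absolute
  value of the product with \<open>a\<close>; reverse Cauchy-Schwarz then applies.\<close>

lemma sqtime_upper:
  assumes p: "p \<in> D" and p': "p' \<in> D"
  shows "sqtime p' \<le> (mink (p' - retr p) (p - retr p))\<^sup>2 / sqtime p"
proof -
  define a where "a = p - retr p"
  define a' where "a' = p' - retr p'"
  have a: "future_timelike a" "future_timelike a'"
    unfolding a_def a'_def by (intro retr_timelike p p')+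
  have neg: "mink a' a < 0"
    using a by (intro future_timelike_causal_neg future_timelike_imp_causal)
  have "mink (retr p' - retr p) a \<le> 0"
    unfolding a_def by (intro retr_support p retr_closure p')
  then have "mink (p' - retr p) a \<le> mink a' a"
    by (simp add: a'_def mink_algebra)
  then have "(mink a' a)\<^sup>2 \<le> (mink (p' - retr p) a)\<^sup>2"
    using neg by (simp add: abs_le_square_iff[symmetric])
  moreover have "sqtime p * sqtime p' \<le> (mink a' a)\<^sup>2"
    using reverse_cauchy_schwarz[of a a'] a
    by (simp add: sqtime_def a_def a'_def future_timelike_def mink_commute)
  ultimately show ?thesis
    using sqtime_pos[OF p] by (simp add: a_def field_simps)
qed

lemma tendsto_sqtime:
  assumes p: "p \<in> D"
  shows "(sqtime \<longlongrightarrow> sqtime p) (at p within D)"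
proof (rule tendsto_sandwich)
  show "\<forall>\<^sub>F x in at p within D. - mink (x - retr p) (x - retr p) \<le> sqtime x"
    using sqtime_lower[OF p] by (auto simp: eventually_at_filter)
  show "\<forall>\<^sub>F x in at p within D. sqtime x \<le> (mink (x - retr p) (p - retr p))\<^sup>2 / sqtime p"
    using sqtime_upper[OF p] by (auto simp: eventually_at_filter)
  show "((\<lambda>x. - mink (x - retr p) (x - retr p)) \<longlongrightarrow> sqtime p) (at p within D)"
    unfolding sqtime_def by (intro tendsto_intros)
  have "((\<lambda>x. (mink (x - retr p) (p - retr p))\<^sup>2 / sqtime p) \<longlongrightarrow>
      (mink (p - retr p) (p - retr p))\<^sup>2 / sqtime p) (at p within D)"
    using sqtime_pos[OF p] by (intro tendsto_intros) auto
  also have "(mink (p - retr p) (p - retr p))\<^sup>2 / sqtime p = sqtime p"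
    using sqtime_pos[OF p] by (simp add: sqtime_def power2_eq_square)
  finally show "((\<lambda>x. (mink (x - retr p) (p - retr p))\<^sup>2 / sqtime p) \<longlongrightarrow> sqtime p) (at p within D)" .
qed

lemma continuous_on_sqtime: "continuous_on D sqtime"
  unfolding continuous_on_def using tendsto_sqtime by blast

section \<open>Cosmological time\<close>

lemma lorentz_length_le:
  assumes \<gamma>: "causal_curve_to D p \<gamma>" and n: "future_timelike n" "mink n n = -1"
  shows "\<gamma> 0 \<in> D" and "lorentz_length \<gamma> \<le> - mink (p - \<gamma> 0) n"
proof -
  let ?d = "\<lambda>t. vector_derivative \<gamma> (at t)"
  obtain S where S: "finite S" "\<forall>t\<in>{0..1} - S. future_causal (?d t)"
    and pw: "\<gamma> piecewise_C1_differentiable_on {0..1}" and img: "\<gamma> ` {0..1} \<subseteq> D" and \<gamma>1: "\<gamma> 1 = p"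
    using \<gamma> by (auto simp: causal_curve_to_def)
  show "\<gamma> 0 \<in> D"
    using img by auto
  obtain N where N: "finite N" "\<gamma> C1_differentiable_on {0..1} - N" and cont: "continuous_on {0..1} \<gamma>"
    using pw by (auto simp: piecewise_C1_differentiable_on_def)
  have "(\<gamma> has_vector_derivative ?d t) (at t)" if "t \<in> {0..1} - N" for t
    using N(2) that by (auto simp: C1_differentiable_on_eq vector_derivative_works)
  then have "(?d has_integral \<gamma> 1 - \<gamma> 0) {0..1}"
    using N(1) cont by (intro fundamental_theorem_of_calculus_strong[of N]) auto
  then have "((\<lambda>t. - mink (?d t) n) has_integral - mink (p - \<gamma> 0) n) {0..1}"
    using has_integral_neg[OF has_integral_linear[OF _ bounded_linear_mink[of n]]] \<gamma>1
    unfolding o_def by blast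
  \<comment> \<open>The velocity may fail to be causal on the finite set \<open>S\<close>, so the
    integrand is altered there by a free \<open>h\<close> to make the comparisons below hold at
    every point.\<close>
  then have hi: "((\<lambda>t. if t \<in> S then h t else - mink (?d t) n) has_integral - mink (p - \<gamma> 0) n) {0..1}"
    for h
    by (rule has_integral_spike_finite[OF S(1), rotated]) auto
  show "lorentz_length \<gamma> \<le> - mink (p - \<gamma> 0) n"
  proof (cases "(\<lambda>t. sqrt (- mink (?d t) (?d t))) integrable_on {0..1}")
    case True
    then have "((\<lambda>t. sqrt (- mink (?d t) (?d t))) has_integral lorentz_length \<gamma>) {0..1}"
      unfolding lorentz_length_def by (rule integrable_integral)
    then show ?thesis
      using hi[of "\<lambda>t. sqrt (- mink (?d t) (?d t))"] by (rule has_integral_le)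
        (use S(2) n in \<open>auto intro: sqrt_mink_le\<close>)
  next
    case False
    \<comment> \<open>A non-integrable function has integral \<open>0\<close> by default, so here
      the bound reduces to its nonnegativity.\<close>
    then have "lorentz_length \<gamma> = 0"
      by (simp add: lorentz_length_def not_integrable_integral)
    moreover have "0 \<le> - mink (p - \<gamma> 0) n"
      using hi[of "\<lambda>_. 0"] by (rule has_integral_nonneg)
        (use S(2) n in \<open>auto intro: future_causal_nonpos future_timelike_imp_causal\<close>)
    ultimately show ?thesis by simp
  qed
qed

text \<open>The point \<open>r\<close> is only assumed to lie in \<open>closure D\<close>, so the
  curve starts a fraction \<delta> of the way from \<open>r\<close> to \<open>p\<close>, which is
  inside \<open>D\<close>.\<close>

lemma lorentz_length_segment:
  assumes p: "p \<in> D" and r: "r \<in> closure D" "future_timelike (p - r)" and \<delta>: "0 < \<delta>" "\<delta> < 1"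
  defines "\<gamma> \<equiv> \<lambda>t. (r + \<delta> *\<^sub>R (p - r)) + t *\<^sub>R ((1 - \<delta>) *\<^sub>R (p - r))"
  shows "causal_curve_to D p \<gamma>" "lorentz_length \<gamma> = (1 - \<delta>) * sqrt (- mink (p - r) (p - r))"
proof -
  let ?w = "(1 - \<delta>) *\<^sub>R (p - r)"
  have der: "(\<gamma> has_vector_derivative ?w) (at t)" for t
    unfolding \<gamma>_def by (auto intro!: derivative_eq_intros)
  then have vd: "vector_derivative \<gamma> (at t) = ?w" for t
    by (rule vector_derivative_at)
  have "\<gamma> C1_differentiable_on {0..1}"
    unfolding C1_differentiable_on_def using der by (intro exI[of _ "\<lambda>_. ?w"]) auto
  moreover have "\<gamma> t \<in> D" if "t \<in> {0..1}" for t
  proof -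
    have "\<gamma> t = r + (\<delta> + t * (1 - \<delta>)) *\<^sub>R (p - r)"
      by (simp add: \<gamma>_def algebra_simps)
    moreover have "\<delta> + t * (1 - \<delta>) > 0"
      using \<delta> that by (intro add_pos_nonneg) auto
    ultimately show ?thesis
      using r by (auto intro!: closure_timelike_future future_timelike_scaleR)
  qed
  moreover have "\<gamma> 1 = p"
    by (simp add: \<gamma>_def algebra_simps)
  moreover have "future_causal ?w"
    using r \<delta> by (intro future_causal_scaleR future_timelike_imp_causal) auto
  ultimately show "causal_curve_to D p \<gamma>"
    by (auto simp: causal_curve_to_def vd intro!: C1_differentiable_imp_piecewise exI[of _ "{}"])
  have "- mink ?w ?w = (1 - \<delta>)\<^sup>2 * (- mink (p - r) (p - r))"
    unfolding mink_self_scaleR by simp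
  then have "sqrt (- mink ?w ?w) = (1 - \<delta>) * sqrt (- mink (p - r) (p - r))"
    using \<delta> by (simp only: real_sqrt_mult real_sqrt_abs)
  then show "lorentz_length \<gamma> = (1 - \<delta>) * sqrt (- mink (p - r) (p - r))"
    by (simp add: lorentz_length_def vd)
qed

text \<open>For the upper bound, curve lengths are measured against the unit vector along
  \<open>p - retr p\<close>, and the support inequality controls the starting point. The segments of
  \<open>lorentz_length_segment\<close> approach this bound as \<delta> tends to
  \<open>0\<close>.\<close>

lemma cosmological_time_eq:
  assumes p: "p \<in> D"
  shows "cosmological_time D p = ereal (sqrt (sqtime p))"
proof (rule antisym)
  define \<tau> where "\<tau> = sqrt (sqtime p)"
  have \<tau>: "\<tau> > 0" "\<tau>\<^sup>2 = sqtime p"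
    using sqtime_pos[OF p] by (auto simp: \<tau>_def)
  define n where "n = (1 / \<tau>) *\<^sub>R (p - retr p)"
  have n: "future_timelike n" "mink n n = -1"
    unfolding n_def mink_self_scaleR using future_timelike_scaleR[OF retr_timelike[OF p]] \<tau>
    by (auto simp: power_divide sqtime_def)
  have "lorentz_length \<gamma> \<le> \<tau>" if "causal_curve_to D p \<gamma>" for \<gamma>
  proof -
    note * = lorentz_length_le[OF that n]
    have "mink (\<gamma> 0 - retr p) (p - retr p) \<le> 0"
      using *(1) closure_subset by (intro retr_support p) blast
    moreover have "p - \<gamma> 0 = (p - retr p) - (\<gamma> 0 - retr p)"
      by simp
    ultimately have "- mink (p - \<gamma> 0) (p - retr p) \<le> sqtime p"
      unfolding sqtime_def by (simp only: mink_algebra)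
    then have "- mink (p - \<gamma> 0) n \<le> sqtime p / \<tau>"
      using divide_right_mono[OF _ less_imp_le[OF \<tau>(1)]] by (fastforce simp: n_def mink_algebra(6))
    also have "\<dots> = \<tau>"
      unfolding \<tau>(2)[symmetric] using \<tau>(1) by (simp add: power2_eq_square)
    finally show ?thesis
      using *(2) by simp
  qed
  then show "cosmological_time D p \<le> ereal (sqrt (sqtime p))"
    by (auto simp: cosmological_time_def \<tau>_def intro!: SUP_least)
  show "ereal (sqrt (sqtime p)) \<le> cosmological_time D p"
  proof (rule tendsto_upperbound)
    show "((\<lambda>\<delta>. ereal ((1 - \<delta>) * sqrt (sqtime p))) \<longlongrightarrow> ereal (sqrt (sqtime p))) (at_right 0)"
      by (auto intro!: tendsto_eq_intros)
    have "ereal ((1 - \<delta>) * sqrt (sqtime p)) \<le> cosmological_time D p" if "\<delta> \<in> {0<..<1}" for \<delta>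
      using lorentz_length_segment[OF p retr_closure[OF p] retr_timelike[OF p], of \<delta>] that
      unfolding cosmological_time_def sqtime_def by (intro SUP_upper2) auto
    then show "\<forall>\<^sub>F \<delta> in at_right 0. ereal ((1 - \<delta>) * sqrt (sqtime p)) \<le> cosmological_time D p"
      by (intro eventually_at_rightI[of 0 1]) auto
  qed simp
qed

lemma level_surface_eq:
  assumes "\<epsilon> > 0"
  shows "level_surface D \<epsilon> = {p \<in> D. sqtime p = \<epsilon>\<^sup>2}"
proof -
  have "cosmological_time D p = ereal \<epsilon> \<longleftrightarrow> sqtime p = \<epsilon>\<^sup>2" if "p \<in> D" for p
    unfolding cosmological_time_eq[OF that]
    using assms sqtime_pos[OF that] real_sqrt_unique[of \<epsilon> "sqtime p"] by auto
  then show ?thesis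
    by (auto simp: level_surface_def)
qed

end


section \<open>Unit normals of the level surfaces\<close>

lemma has_real_derivative_mink_self:
  assumes "(g has_vector_derivative w) (at t)"
  shows "((\<lambda>t. mink (g t) (g t)) has_real_derivative 2 * mink (g t) w) (at t)"
proof -
  have c: "((\<lambda>t. g t $ i) has_real_derivative w $ i) (at t)" for i
    using bounded_linear.has_vector_derivative[OF bounded_linear_vec_nth assms]
    by (simp add: has_real_derivative_iff_has_vector_derivative)
  show ?thesis
    unfolding mink_def by (rule derivative_eq_intros c refl)+ (simp add: algebra_simps)
qed

context dependence_domain
begin

text \<open>Along a curve in the level surface \<open>sqtime\<close> is constant, so
  \<open>sqtime_lower\<close>, an equality at \<open>p\<close>, gives \<open>F\<close> a local
  minimum at \<open>0\<close>; its derivative there vanishes.\<close>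

lemma tangent_vectors_level_perp:
  assumes p: "p \<in> D" and T: "sqtime p = \<epsilon>\<^sup>2" and \<epsilon>: "\<epsilon> > 0"
    and w: "w \<in> tangent_vectors (level_surface D \<epsilon>) p"
  shows "mink (p - retr p) w = 0"
proof -
  obtain \<gamma> where \<gamma>: "\<gamma> 0 = p" "(\<gamma> has_vector_derivative w) (at 0)"
    "\<forall>\<^sub>F t in at 0. \<gamma> t \<in> level_surface D \<epsilon>"
    using w by (auto simp: tangent_vectors_def)
  define F where "F t = mink (\<gamma> t - retr p) (\<gamma> t - retr p)" for t
  have "((\<lambda>t. \<gamma> t - retr p) has_vector_derivative w) (at 0)"
    using has_vector_derivative_diff_const \<gamma>(2) by auto
  then have F': "(F has_real_derivative 2 * mink (\<gamma> 0 - retr p) w) (at 0)"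
    unfolding F_def by (rule has_real_derivative_mink_self)
  have "\<forall>\<^sub>F t in at 0. F 0 \<le> F t"
    using \<gamma>(3)
  proof eventually_elim
    case (elim t)
    then have "\<gamma> t \<in> D" "sqtime (\<gamma> t) = sqtime p"
      using T by (auto simp: level_surface_eq[OF \<epsilon>])
    then show ?case
      using sqtime_lower[OF p, of "\<gamma> t"] by (simp add: F_def \<gamma>(1)) (simp add: sqtime_def)
  qed
  then obtain d where d: "d > 0" "\<forall>t. t \<noteq> 0 \<and> dist t 0 < d \<longrightarrow> F 0 \<le> F t"
    by (auto simp: eventually_at)
  then have "\<forall>t. \<bar>0 - t\<bar> < d \<longrightarrow> F 0 \<le> F t"
    by (metis abs_minus_commute diff_0_right dist_real_def order_refl)
  from DERIV_local_min[OF F' d(1) this] show ?thesis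
    by (simp add: \<gamma>(1))
qed

text \<open>Over \<open>p + t w\<close> the level surface lies at a height \<open>\<sigma> t\<close> in the direction of \<open>p - retr p\<close>,
  and the two bounds on \<open>sqtime\<close> squeeze \<open>\<sigma> t\<close> between \<open>0\<close> and \<open>C t\<^sup>2\<close>.\<close>

lemma perp_in_tangent_vectors_level:
  assumes p: "p \<in> D" and T: "sqtime p = \<epsilon>\<^sup>2" and \<epsilon>: "\<epsilon> > 0"
    and w: "mink (p - retr p) w = 0"
  shows "w \<in> tangent_vectors (level_surface D \<epsilon>) p"
proof -
  define a where "a = p - retr p"
  have a: "future_timelike a" and aa: "mink a a = - \<epsilon>\<^sup>2" and aw: "mink a w = 0"
    using retr_timelike[OF p] T w by (auto simp: a_def sqtime_def)
  have ww: "mink w w \<ge> 0"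
    using timelike_perp(1)[OF _ aw] a by (simp add: future_timelike_def)
  define C where "C = mink w w / \<epsilon>\<^sup>2"
  have C0: "C \<ge> 0"
    using ww by (simp add: C_def)
  have "\<forall>\<^sub>F t in at (0::real). p + t *\<^sub>R w \<in> D"
    by (rule topological_tendstoD[OF _ D_open p]) (auto intro!: tendsto_eq_intros)
  then obtain d where d: "d > 0" "\<And>t. t \<noteq> 0 \<Longrightarrow> \<bar>t\<bar> < d \<Longrightarrow> p + t *\<^sub>R w \<in> D"
    by (auto simp: eventually_at dist_real_def)
  have inD: "p + t *\<^sub>R w + s *\<^sub>R a \<in> D" if "\<bar>t\<bar> < d" "s \<ge> 0" for t s
  proof -
    have "p + t *\<^sub>R w \<in> D"
      using d(2)[of t] that p by (cases "t = 0") auto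
    then show ?thesis
      using that(2) D_future[OF _ future_causal_scaleR[OF future_timelike_imp_causal[OF a]]]
      by (cases "s = 0") auto
  qed
  have rel: "p + t *\<^sub>R w + s *\<^sub>R a - retr p = (1 + s) *\<^sub>R a + t *\<^sub>R w" for t s
    by (simp add: a_def algebra_simps)
  have lower: "(1 + s)\<^sup>2 * \<epsilon>\<^sup>2 - t\<^sup>2 * mink w w \<le> sqtime (p + t *\<^sub>R w + s *\<^sub>R a)"
    if "\<bar>t\<bar> < d" "s \<ge> 0" for t s
    using sqtime_lower[OF p inD[OF that]] unfolding rel mink_self_add mink_self_scaleR
    by (simp add: mink_algebra(5,6) aw aa)
  have upper: "sqtime (p + t *\<^sub>R w) \<le> \<epsilon>\<^sup>2" if "\<bar>t\<bar> < d" for t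
  proof -
    have "p + t *\<^sub>R w - retr p = a + t *\<^sub>R w"
      by (simp add: a_def)
    then have "mink (p + t *\<^sub>R w - retr p) a = - \<epsilon>\<^sup>2"
      by (simp only: mink_algebra(1,5) mink_commute[of w a] aw aa)
    then show ?thesis
      using sqtime_upper[OF p inD[OF that, of 0]] \<epsilon> unfolding T a_def[symmetric]
      by (simp add: power2_eq_square)
  qed
  have "\<exists>s. \<bar>t\<bar> < d \<longrightarrow> 0 \<le> s \<and> s \<le> C * t\<^sup>2 \<and> sqtime (p + t *\<^sub>R w + s *\<^sub>R a) = \<epsilon>\<^sup>2" for t
  proof (cases "\<bar>t\<bar> < d")
    case True
    \<comment> \<open>The constant \<open>C\<close> is chosen so that raising the point by
      \<open>C\<close> times the square of \<open>t\<close> more than compensates the loss from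
      \<open>mink w w\<close>, already by the linear term of the square.\<close>
    have "\<exists>s\<ge>0. s \<le> C * t\<^sup>2 \<and> sqtime (p + t *\<^sub>R w + s *\<^sub>R a) = \<epsilon>\<^sup>2"
    proof (rule IVT')
      show "sqtime (p + t *\<^sub>R w + 0 *\<^sub>R a) \<le> \<epsilon>\<^sup>2"
        using upper[OF True] by simp
      have "\<epsilon>\<^sup>2 \<le> (1 + 2 * (C * t\<^sup>2)) * \<epsilon>\<^sup>2 - t\<^sup>2 * mink w w"
        using ww \<epsilon> by (simp add: C_def field_simps)
      also have "\<dots> \<le> (1 + C * t\<^sup>2)\<^sup>2 * \<epsilon>\<^sup>2 - t\<^sup>2 * mink w w"
        by (intro diff_right_mono mult_right_mono) (auto simp: power2_sum)
      also have "\<dots> \<le> sqtime (p + t *\<^sub>R w + (C * t\<^sup>2) *\<^sub>R a)"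
        using C0 by (intro lower True) simp
      finally show "\<epsilon>\<^sup>2 \<le> sqtime (p + t *\<^sub>R w + (C * t\<^sup>2) *\<^sub>R a)" .
      show "0 \<le> C * t\<^sup>2"
        using C0 by simp
      show "continuous_on {0..C * t\<^sup>2} (\<lambda>s. sqtime (p + t *\<^sub>R w + s *\<^sub>R a))"
        by (intro continuous_on_compose2[OF continuous_on_sqtime] continuous_intros)
          (use inD[OF True] in auto)
    qed
    then show ?thesis by blast
  qed auto
  then obtain \<sigma> where \<sigma>: "\<And>t. \<bar>t\<bar> < d \<Longrightarrow> 0 \<le> \<sigma> t" "\<And>t. \<bar>t\<bar> < d \<Longrightarrow> \<sigma> t \<le> C * t\<^sup>2"
    "\<And>t. \<bar>t\<bar> < d \<Longrightarrow> sqtime (p + t *\<^sub>R w + \<sigma> t *\<^sub>R a) = \<epsilon>\<^sup>2"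
    by metis
  have \<sigma>0: "\<sigma> 0 = 0"
    using \<sigma>(1,2)[of 0] d(1) by simp
  have ev: "\<forall>\<^sub>F t in at (0::real). \<bar>t\<bar> < d"
    using d(1) unfolding eventually_at by (intro exI[of _ d]) (auto simp: dist_real_def)
  have "((\<lambda>t. (\<sigma> (0 + t) - \<sigma> 0) / t) \<longlongrightarrow> 0) (at 0)"
  proof (rule Lim_null_comparison)
    show "\<forall>\<^sub>F t in at 0. norm ((\<sigma> (0 + t) - \<sigma> 0) / t) \<le> C * \<bar>t\<bar>"
      using ev eventually_neq_at_within[of 0 0]
    proof eventually_elim
      case (elim t)
      have "\<bar>\<sigma> t\<bar> \<le> C * \<bar>t\<bar> * \<bar>t\<bar>"
        using \<sigma>(1,2)[OF elim(1)] by (simp add: power2_eq_square)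
      then show ?case
        using elim(2) by (simp add: \<sigma>0 abs_divide divide_le_eq)
    qed
    show "((\<lambda>t. C * \<bar>t\<bar>) \<longlongrightarrow> 0) (at 0)"
      by (auto intro!: tendsto_eq_intros)
  qed
  then have \<sigma>': "(\<sigma> has_real_derivative 0) (at 0)"
    by (simp add: DERIV_def)
  show ?thesis
    unfolding tangent_vectors_def mem_Collect_eq
  proof (intro exI[of _ "\<lambda>t. p + t *\<^sub>R w + \<sigma> t *\<^sub>R a"] conjI)
    show "p + 0 *\<^sub>R w + \<sigma> 0 *\<^sub>R a = p"
      by (simp add: \<sigma>0)
    show "((\<lambda>t. p + t *\<^sub>R w + \<sigma> t *\<^sub>R a) has_vector_derivative w) (at 0)"
      by (rule derivative_eq_intros \<sigma>' refl)+ simp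
    show "\<forall>\<^sub>F t in at 0. p + t *\<^sub>R w + \<sigma> t *\<^sub>R a \<in> level_surface D \<epsilon>"
      using ev by eventually_elim (auto simp: level_surface_eq[OF \<epsilon>] intro: inD \<sigma>)
  qed
qed

text \<open>Tangent vectors are exactly those orthogonal to \<open>a\<close>. For another normal
  \<open>n\<close>, its component \<open>w\<close> orthogonal to \<open>a\<close> is tangent, hence
  orthogonal to \<open>n\<close> and to itself, and so zero; \<open>n\<close> is then a multiple of
  \<open>a\<close> fixed by its length.\<close>

lemma future_unit_normal_level:
  assumes p: "p \<in> D" and T: "sqtime p = \<epsilon>\<^sup>2" and \<epsilon>: "\<epsilon> > 0"
  shows "future_unit_normal (level_surface D \<epsilon>) p = (1 / \<epsilon>) *\<^sub>R (p - retr p)"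
  unfolding future_unit_normal_def
proof (rule the_equality, intro conjI ballI)
  define a where "a = p - retr p"
  have a: "future_timelike a" and aa: "mink a a = - \<epsilon>\<^sup>2"
    using retr_timelike[OF p] T by (auto simp: a_def sqtime_def)
  show "future_timelike ((1 / \<epsilon>) *\<^sub>R (p - retr p))"
    using a \<epsilon> unfolding a_def by (intro future_timelike_scaleR) auto
  show "mink ((1 / \<epsilon>) *\<^sub>R (p - retr p)) ((1 / \<epsilon>) *\<^sub>R (p - retr p)) = - 1"
    unfolding mink_self_scaleR a_def[symmetric] aa using \<epsilon> by (simp add: power_divide)
  show "mink ((1 / \<epsilon>) *\<^sub>R (p - retr p)) w = 0" if "w \<in> tangent_vectors (level_surface D \<epsilon>) p" for w
    using tangent_vectors_level_perp[OF p T \<epsilon> that] by (simp add: mink_algebra(5))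
  fix n
  assume "future_timelike n \<and> mink n n = - 1 \<and>
    (\<forall>w\<in>tangent_vectors (level_surface D \<epsilon>) p. mink n w = 0)"
  then have n: "future_timelike n" "mink n n = -1"
    and perp: "\<And>w. mink a w = 0 \<Longrightarrow> mink n w = 0"
    using perp_in_tangent_vectors_level[OF p T \<epsilon>] by (auto simp: a_def)
  define k where "k = - mink a n / \<epsilon>\<^sup>2"
  define w where "w = n - k *\<^sub>R a"
  have aw: "mink a w = 0"
    using \<epsilon> by (simp add: w_def mink_algebra aa k_def)
  have "mink w w = mink n w - k * mink a w"
    by (subst (1) w_def) (simp add: mink_algebra)
  then have "mink w w = 0"
    using aw perp[OF aw] by simp
  then have "w = 0"
    using timelike_perp(2)[OF _ aw] a by (simp add: future_timelike_def)
  then have nk: "n = k *\<^sub>R a"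
    by (simp add: w_def)
  then have "(k * \<epsilon>)\<^sup>2 = 1"
    using n(2) by (simp add: mink_self_scaleR aa power_mult_distrib)
  moreover have "k > 0"
    using n(1) a nk by (simp add: future_timelike_def zero_less_mult_iff)
  ultimately have "k * \<epsilon> = 1"
    using \<epsilon> by (intro power2_eq_imp_eq[of _ 1]) auto
  then have "k = 1 / \<epsilon>"
    using \<epsilon> by (simp add: field_simps)
  then show "n = (1 / \<epsilon>) *\<^sub>R (p - retr p)"
    unfolding nk a_def by simp
qed

end


section \<open>Semicontinuity and category\<close>

lemma upper_semicontinuous_discontinuities_meagre:
  fixes f :: "'a::t2_space \<Rightarrow> real"
  assumes usc: "upper_semicontinuous_on S f"
  shows "meagre_in (top_of_set S) {x \<in> S. \<not> continuous (at x within S) f}"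
proof -
  let ?X = "top_of_set S"
  define U where "U a = {x \<in> S. f x < a}" for a
  define \<Delta> where "\<Delta> = {x \<in> S. \<not> continuous (at x within S) f}"
  \<comment> \<open>Intersecting with the discontinuity set makes the union equal to it, as
    \<open>meagre_in\<close> requires.\<close>
  define N where "N a = (?X closure_of U a - U a) \<inter> \<Delta>" for a
  have openU: "openin ?X (U a)" for a
  proof (subst openin_subopen, intro ballI)
    fix x assume x: "x \<in> U a"
    then have "\<forall>\<^sub>F y in at x within S. f y < a"
      using usc by (auto simp: upper_semicontinuous_on_def U_def)
    then obtain V where V: "open V" "x \<in> V" "\<forall>y\<in>V. y \<noteq> x \<longrightarrow> y \<in> S \<longrightarrow> f y < a"
      by (auto simp: eventually_at_topological)
    then have "S \<inter> V \<subseteq> U a"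
      using x by (auto simp: U_def)
    with V x show "\<exists>W. openin ?X W \<and> x \<in> W \<and> W \<subseteq> U a"
      by (intro exI[of _ "S \<inter> V"]) (auto simp: U_def openin_open_Int)
  qed
  have "nowhere_dense_in ?X (N a)" for a
    unfolding nowhere_dense_in_def
  proof
    show "N a \<subseteq> topspace ?X"
      by (auto simp: N_def \<Delta>_def)
    let ?B = "?X closure_of U a - U a"
    have "closedin ?X ?B"
      by (intro closedin_diff openU closedin_closure_of)
    then have "?X closure_of N a \<subseteq> ?B"
      by (intro closure_of_minimal) (auto simp: N_def)
    \<comment> \<open>An open set disjoint from \<open>U a\<close> is disjoint from its closure as
      well.\<close>
    moreover have "W = {}" if W: "openin ?X W" "W \<subseteq> ?B" for W
    proof -
      have "W \<inter> U a = {}"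
        using W(2) by blast
      then have "W \<inter> ?X closure_of U a = {}"
        using openin_Int_closure_of_eq_empty[OF W(1)] by blast
      then show ?thesis
        using W(2) by blast
    qed
    ultimately show "?X interior_of (?X closure_of N a) = {}"
      by (meson interior_of_subset openin_interior_of subset_trans)
  qed
  moreover have "\<Delta> = \<Union>(N ` \<rat>)"
  proof (intro equalityI subsetI)
    fix x assume x: "x \<in> \<Delta>"
    show "x \<in> \<Union>(N ` \<rat>)"
    proof (rule ccontr)
      assume nN: "x \<notin> \<Union>(N ` \<rat>)"
      have "(f \<longlongrightarrow> f x) (at x within S)"
      proof (rule order_tendstoI)
        fix a assume "f x < a"
        then show "\<forall>\<^sub>F y in at x within S. f y < a"
          using usc x by (auto simp: upper_semicontinuous_on_def \<Delta>_def)
      next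
        \<comment> \<open>For a rational \<open>a\<close> between \<open>b\<close> and
          \<open>f x\<close>, the point \<open>x\<close> is outside \<open>U a\<close> and, being
          outside \<open>N a\<close>, also outside its closure; so \<open>f\<close> is at least
          \<open>a\<close> near \<open>x\<close>.\<close>
        fix b assume "b < f x"
        then obtain a where a: "a \<in> \<rat>" "b < a" "a < f x"
          using Rats_dense_in_real by blast
        have "x \<notin> ?X closure_of U a"
          using nN a x by (auto simp: N_def U_def)
        then obtain V where V: "openin ?X V" "x \<in> V" "V \<inter> U a = {}"
          using x by (auto simp: closure_of_def \<Delta>_def)
        then obtain V' where V': "open V'" "V = S \<inter> V'"
          by (auto simp: openin_open)
        show "\<forall>\<^sub>F y in at x within S. b < f y"
          unfolding eventually_at_topological
          using V V' a(2) by (intro exI[of _ V']) (auto simp: U_def not_less disjoint_iff)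
      qed
      then show False
        using x by (auto simp: \<Delta>_def continuous_within)
    qed
  qed (auto simp: N_def)
  ultimately show ?thesis
    unfolding meagre_in_def \<Delta>_def[symmetric]
    by (intro exI[of _ "N ` \<rat>"]) (auto intro: countable_rat)
qed

section \<open>The function iota\<close>

locale observer = dependence_domain +
  fixes v :: "real^3"
  assumes v: "future_timelike v" and unit: "mink v v = -1"
begin

text \<open>The line reaches the future of any \<open>p0\<close> in \<open>D\<close>, since
  \<open>v + h (x - p0)\<close> is timelike for small \<open>h\<close>, and
  \<open>timelike_bound\<close> stops it in the past. So a least parameter in the closure
  exists.\<close>

lemma ex_height: "\<exists>u. \<forall>s. (x + s *\<^sub>R v \<in> D \<longleftrightarrow> u < s) \<and> (x + s *\<^sub>R v \<in> closure D \<longleftrightarrow> u \<le> s)"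
proof -
  define S where "S = {s. x + s *\<^sub>R v \<in> closure D}"
  define u where "u = Inf S"
  obtain p0 where p0: "p0 \<in> D"
    using D_nonempty by blast
  have "((\<lambda>h. v + h *\<^sub>R (x - p0)) \<longlongrightarrow> v) (at_right 0)"
    by (auto intro!: tendsto_eq_intros)
  then obtain h where h: "h > 0" "future_timelike (v + h *\<^sub>R (x - p0))"
    using eventually_at_right_0_witness eventually_future_timelike[OF _ v] by blast
  have "p0 + (1 / h) *\<^sub>R (v + h *\<^sub>R (x - p0)) \<in> closure D"
    using h p0 by (intro closure_future future_causal_scaleR future_timelike_imp_causal
        subsetD[OF closure_subset]) auto
  moreover have "p0 + (1 / h) *\<^sub>R (v + h *\<^sub>R (x - p0)) = x + (1 / h) *\<^sub>R v"
    using h by (simp add: algebra_simps)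
  ultimately have "1 / h \<in> S"
    by (simp add: S_def)
  then have ne: "S \<noteq> {}" by blast
  obtain m c where m: "future_timelike m" "\<And>y. y \<in> closure D \<Longrightarrow> mink y m \<le> c"
    using timelike_bound by blast
  have vm: "mink v m < 0"
    using v m(1) by (intro future_timelike_causal_neg future_timelike_imp_causal)
  have "(mink x m - c) / (- mink v m) \<le> s" if "s \<in> S" for s
  proof -
    have "mink x m + s * mink v m \<le> c"
      using m(2)[of "x + s *\<^sub>R v"] that by (simp add: S_def mink_algebra)
    then show ?thesis
      using vm by (simp add: divide_le_eq field_simps)
  qed
  then have bdd: "bdd_below S"
    by (intro bdd_belowI)
  have "closed ((\<lambda>s. x + s *\<^sub>R v) -` closure D)"
    by (intro closed_vimage continuous_intros closed_closure)
  then have "closed S"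
    by (simp add: S_def vimage_def)
  then have uS: "u \<in> S"
    unfolding u_def using closed_contains_Inf[OF ne bdd] by blast
  have inD: "x + s *\<^sub>R v \<in> D" if "u < s" for s
  proof -
    have "x + u *\<^sub>R v + (s - u) *\<^sub>R v \<in> D"
      using uS that v by (intro closure_timelike_future future_timelike_scaleR) (auto simp: S_def)
    then show ?thesis
      by (simp add: algebra_simps)
  qed
  have inS: "u \<le> s" if "s \<in> S" for s
    unfolding u_def by (rule cInf_lower[OF that bdd])
  have "x + u *\<^sub>R v \<notin> D"
  proof
    assume *: "x + u *\<^sub>R v \<in> D"
    have "\<forall>\<^sub>F h in at_right (0::real). x + (u - h) *\<^sub>R v \<in> D"
      by (rule topological_tendstoD[OF _ D_open *]) (auto intro!: tendsto_eq_intros)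
    then obtain h where "h > 0" "x + (u - h) *\<^sub>R v \<in> D"
      by (rule eventually_at_right_0_witness)
    then show False
      using inS[of "u - h"] closure_subset by (auto simp: S_def)
  qed
  then have "u < s" if "x + s *\<^sub>R v \<in> D" for s
    using inS[of s] that closure_subset by (cases "s = u") (auto simp: S_def less_le)
  moreover have "x + s *\<^sub>R v \<in> closure D" if "u \<le> s" for s
    using inD[of s] uS that closure_subset by (cases "s = u") (auto simp: S_def)
  ultimately show ?thesis
    using inD inS by (intro exI[of _ u]) (auto simp: S_def)
qed

definition height :: "real^3 \<Rightarrow> real" where
  "height x = graph_height (frontier D) v x"

lemma
  shows mem_D_iff: "x + s *\<^sub>R v \<in> D \<longleftrightarrow> height x < s"
    and mem_closure_iff: "x + s *\<^sub>R v \<in> closure D \<longleftrightarrow> height x \<le> s"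
    and mem_frontier_iff: "x + s *\<^sub>R v \<in> frontier D \<longleftrightarrow> s = height x"
proof -
  obtain u where u: "\<And>s. x + s *\<^sub>R v \<in> D \<longleftrightarrow> u < s" "\<And>s. x + s *\<^sub>R v \<in> closure D \<longleftrightarrow> u \<le> s"
    using ex_height by blast
  have fr: "x + s *\<^sub>R v \<in> frontier D \<longleftrightarrow> s = u" for s
    using u by (auto simp: frontier_def interior_open[OF D_open])
  then have "height x = u"
    by (simp add: height_def graph_height_def)
  with u fr show "x + s *\<^sub>R v \<in> D \<longleftrightarrow> height x < s"
    "x + s *\<^sub>R v \<in> closure D \<longleftrightarrow> height x \<le> s"
    "x + s *\<^sub>R v \<in> frontier D \<longleftrightarrow> s = height x"
    by blast+
qed

text \<open>The value of \<open>iota_eps\<close> on the level surface through \<open>p\<close>, and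
  half the derivative of \<open>sqtime\<close> in the direction \<open>v\<close>.\<close>

definition slope :: "real^3 \<Rightarrow> real" where
  "slope p = - mink (p - retr p) v"

lemma slope_pos: "p \<in> D \<Longrightarrow> slope p > 0"
  using future_timelike_causal_neg[OF retr_timelike future_timelike_imp_causal[OF v]]
  by (simp add: slope_def)

lemma sqtime_shift_lower:
  assumes "p \<in> D" "p + h *\<^sub>R v \<in> D"
  shows "sqtime p + 2 * h * slope p + h\<^sup>2 \<le> sqtime (p + h *\<^sub>R v)"
proof -
  have "p + h *\<^sub>R v - retr p = (p - retr p) + h *\<^sub>R v"
    by simp
  then show ?thesis
    using sqtime_lower[OF assms]
    by (simp only: mink_self_add mink_algebra(5,6) unit)
      (simp add: sqtime_def slope_def power2_eq_square)
qed

lemma sqtime_shift_upper: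
  assumes "p \<in> D" "p + h *\<^sub>R v \<in> D"
  shows "sqtime (p + h *\<^sub>R v) \<le> sqtime p + 2 * h * slope p + h\<^sup>2 * ((slope p)\<^sup>2 / sqtime p)"
proof -
  have "p + h *\<^sub>R v - retr p = (p - retr p) + h *\<^sub>R v"
    by simp
  then have "mink (p + h *\<^sub>R v - retr p) (p - retr p) = - (sqtime p + h * slope p)"
    by (simp only: mink_algebra(1,5) mink_commute[of v]) (simp add: sqtime_def slope_def)
  then have "sqtime (p + h *\<^sub>R v) \<le> (sqtime p + h * slope p)\<^sup>2 / sqtime p"
    using sqtime_upper[OF assms] by (simp only: power2_minus)
  also have "\<dots> = sqtime p + 2 * h * slope p + h\<^sup>2 * ((slope p)\<^sup>2 / sqtime p)"
    using sqtime_pos[OF assms(1)] by (simp add: field_simps power2_eq_square)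
  finally show ?thesis .
qed

text \<open>Adding \<open>sqtime_shift_lower\<close> for the step from \<open>p\<close> up to
  \<open>p + h v\<close> and for the step back cancels the values of \<open>sqtime\<close>.\<close>

lemma slope_shift:
  assumes p: "p \<in> D" and h: "h > 0"
  shows "p + h *\<^sub>R v \<in> D" and "slope p + h \<le> slope (p + h *\<^sub>R v)"
proof -
  show q: "p + h *\<^sub>R v \<in> D"
    using v h by (intro D_future p future_causal_scaleR future_timelike_imp_causal)
  have "sqtime (p + h *\<^sub>R v) - 2 * h * slope (p + h *\<^sub>R v) + h\<^sup>2 \<le> sqtime p"
    using sqtime_shift_lower[OF q, of "- h"] p by simp
  then have "h * (slope p + h) \<le> h * slope (p + h *\<^sub>R v)"
    using sqtime_shift_lower[OF p q] by (simp add: power2_eq_square algebra_simps)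
  then show "slope p + h \<le> slope (p + h *\<^sub>R v)"
    using h by simp
qed

text \<open>The reverse Cauchy-Schwarz inequality is applied to \<open>n + h v\<close>, where \<open>n\<close> is normal to a
  lightlike support plane at \<open>q\<close>.\<close>

lemma sqtime_near_boundary:
  assumes q: "q \<notin> D" and h: "h > 0" and p: "q + h *\<^sub>R v \<in> D"
  shows "sqtime (q + h *\<^sub>R v) \<le> h * (1 + slope (q + h *\<^sub>R v))\<^sup>2 / 2"
proof -
  obtain n0 c0 where n0: "lightlike n0" "n0 $ 0 > 0" "c0 \<le> mink q n0"
    "\<And>y. y \<in> closure D \<Longrightarrow> mink y n0 \<le> c0"
    using null_support_closure[OF q] by metis
  \<comment> \<open>Normalises the null normal to product \<open>-1\<close> with \<open>v\<close>;
    as \<open>p\<close> is \<open>h\<close> above \<open>q\<close>, the support inequality then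
    reads \<open>- mink a n \<le> h\<close>.\<close>
  define k where "k = - 1 / mink v n0"
  have vn0: "mink v n0 < 0"
    using v n0 by (intro future_timelike_causal_neg lightlike_future_causal)
  then have k: "k > 0"
    by (simp add: k_def)
  define n where "n = k *\<^sub>R n0"
  have n: "lightlike n" "n $ 0 > 0"
    unfolding n_def using k n0 lightlike_scaleR by auto
  have vn: "mink v n = -1"
    using vn0 by (simp add: n_def k_def mink_algebra)
  define p where "p = q + h *\<^sub>R v"
  define a where "a = p - retr p"
  have pD: "p \<in> D"
    using assms by (simp add: p_def)
  have a: "future_timelike a"
    unfolding a_def by (rule retr_timelike[OF pD])
  have "mink (retr p) n0 \<le> mink q n0"
    using n0(3) n0(4)[OF retr_closure[OF pD]] by simp
  then have "mink (retr p) n \<le> mink q n"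
    using k by (simp add: n_def mink_algebra)
  then have an1: "- mink a n \<le> h"
    by (simp add: a_def p_def mink_algebra vn)
  have an0: "mink a n \<le> 0"
    using a n by (intro future_causal_nonpos future_timelike_imp_causal lightlike_future_causal)
  define z where "z = n + h *\<^sub>R v"
  have zz: "mink z z = - (2 * h + h\<^sup>2)"
    using n(1) unfolding z_def mink_self_add mink_self_scaleR
    by (simp add: mink_algebra mink_commute[of n v] vn unit lightlike_def)
  have "2 * h + h\<^sup>2 > 0"
    using h by (intro add_pos_pos) auto
  then have "mink z z * mink a a \<le> (mink z a)\<^sup>2"
    using zz by (intro reverse_cauchy_schwarz) simp
  moreover have "mink a a = - sqtime p"
    by (simp add: a_def sqtime_def)
  ultimately have Tz: "(2 * h + h\<^sup>2) * sqtime p \<le> (mink z a)\<^sup>2"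
    unfolding zz by (simp only: minus_mult_minus)
  have hT: "2 * h * sqtime p \<le> (2 * h + h\<^sup>2) * sqtime p"
    using sqtime_pos[OF pD] by (intro mult_right_mono) auto
  have "mink z a = - (- mink a n + h * slope p)"
    by (simp add: z_def mink_algebra mink_commute slope_def a_def algebra_simps)
  moreover have "h * slope p > 0"
    using h slope_pos[OF pD] by simp
  ultimately have z2: "(mink z a)\<^sup>2 \<le> (h * (1 + slope p))\<^sup>2"
    using an0 an1
    by (simp only: power2_minus) (intro power_mono, auto simp: algebra_simps)
  have "h * (2 * sqtime p) \<le> h * (h * (1 + slope p)\<^sup>2)"
    using Tz hT z2 by (simp add: power_mult_distrib power2_eq_square algebra_simps)
  then show ?thesis
    using h by (simp add: p_def)
qed

text \<open>The slope increases along the line, so its value one unit above the boundary bounds it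
  below that point, and \<open>sqtime_near_boundary\<close> becomes a bound \<open>h * K\<close>
  with fixed \<open>K\<close>.\<close>

lemma ex_sqtime_less:
  assumes "\<eta> > 0" "height x < s0"
  shows "\<exists>s. height x < s \<and> s < s0 \<and> sqtime (x + s *\<^sub>R v) < \<eta>"
proof -
  define q where "q = x + height x *\<^sub>R v"
  have q: "q + h *\<^sub>R v = x + (height x + h) *\<^sub>R v" for h
    by (simp add: q_def algebra_simps)
  have qD: "q \<notin> D"
    using q[of 0] mem_D_iff[of x "height x"] by simp
  define K where "K = (1 + slope (q + 1 *\<^sub>R v))\<^sup>2 / 2"
  have "((\<lambda>h. h * K) \<longlongrightarrow> 0) (at_right 0)"
    by (auto intro!: tendsto_eq_intros)
  then have "\<forall>\<^sub>F h in at_right 0. h * K < \<eta>"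
    using assms(1) by (rule order_tendstoD)
  moreover have "\<forall>\<^sub>F h in at_right 0. h < min 1 (s0 - height x)"
    using assms(2) by (intro eventually_at_rightI[of 0 "min 1 (s0 - height x)"]) auto
  ultimately have "\<forall>\<^sub>F h in at_right 0. h * K < \<eta> \<and> h < min 1 (s0 - height x)"
    by (rule eventually_conj)
  then obtain h where h: "h > 0" "h * K < \<eta>" "h < 1" "h < s0 - height x"
    by (auto elim: eventually_at_right_0_witness)
  have pD: "q + h *\<^sub>R v \<in> D"
    unfolding q mem_D_iff using h by simp
  have "slope (q + h *\<^sub>R v) + (1 - h) \<le> slope (q + h *\<^sub>R v + (1 - h) *\<^sub>R v)"
    using h by (intro slope_shift pD) auto
  then have "slope (q + h *\<^sub>R v) \<le> slope (q + 1 *\<^sub>R v)"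
    using h by (simp add: algebra_simps)
  then have "(1 + slope (q + h *\<^sub>R v))\<^sup>2 \<le> (1 + slope (q + 1 *\<^sub>R v))\<^sup>2"
    using slope_pos[OF pD] by (intro power_mono) auto
  then have "h * (1 + slope (q + h *\<^sub>R v))\<^sup>2 / 2 \<le> h * K"
    using h unfolding K_def by simp
  then have "sqtime (q + h *\<^sub>R v) < \<eta>"
    using sqtime_near_boundary[OF qD h(1) pD] h by linarith
  then show ?thesis
    using h unfolding q by (intro exI[of _ "height x + h"]) auto
qed

section \<open>The limit of \<open>iota_eps\<close> as an infimum of slopes\<close>

lemma iota_eps_eq:
  assumes s: "height x < s" and T: "sqtime (x + s *\<^sub>R v) = \<epsilon>\<^sup>2" and \<epsilon>: "\<epsilon> > 0"
  shows "iota_eps D v \<epsilon> x = slope (x + s *\<^sub>R v)"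
proof -
  \<comment> \<open>Strict growth along the line makes the height selected by \<open>THE\<close>
    unique.\<close>
  have less: "sqtime (x + s *\<^sub>R v) < sqtime (x + t *\<^sub>R v)" if "height x < s" "s < t" for s t
  proof -
    have p: "x + s *\<^sub>R v \<in> D"
      using that by (simp add: mem_D_iff)
    have "x + s *\<^sub>R v + (t - s) *\<^sub>R v \<in> D"
      using that by (intro slope_shift p) simp
    from sqtime_shift_lower[OF p this] have
      "sqtime (x + s *\<^sub>R v) + 2 * (t - s) * slope (x + s *\<^sub>R v) + (t - s)\<^sup>2 \<le> sqtime (x + t *\<^sub>R v)"
      by (simp add: algebra_simps)
    moreover have "2 * (t - s) * slope (x + s *\<^sub>R v) > 0"
      using slope_pos[OF p] that by simp
    ultimately show ?thesis
      using zero_le_power2[of "t - s"] by linarith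
  qed
  have "graph_height (level_surface D \<epsilon>) v x = s"
    unfolding graph_height_def
  proof (rule the_equality)
    show "x + s *\<^sub>R v \<in> level_surface D \<epsilon>"
      using s T by (simp add: level_surface_eq[OF \<epsilon>] mem_D_iff)
    fix t assume "x + t *\<^sub>R v \<in> level_surface D \<epsilon>"
    then have "height x < t" "sqtime (x + t *\<^sub>R v) = sqtime (x + s *\<^sub>R v)"
      using T by (auto simp: level_surface_eq[OF \<epsilon>] mem_D_iff)
    then show "t = s"
      using less[of s t] less[of t s] s by (cases t s rule: linorder_cases) auto
  qed
  moreover have "x + s *\<^sub>R v \<in> D"
    using s by (simp add: mem_D_iff)
  ultimately show ?thesis
    using \<epsilon> by (simp add: iota_eps_def future_unit_normal_level[OF _ T \<epsilon>] mink_algebra(5) slope_def)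
qed

lemma slope_bdd_below: "bdd_below ((\<lambda>s. slope (x + s *\<^sub>R v)) ` {height x<..})"
  using slope_pos by (intro bdd_belowI[of _ 0]) (auto simp: mem_D_iff less_imp_le)

text \<open>By the intermediate value theorem and \<open>ex_sqtime_less\<close>, level surfaces of
  small \<epsilon> meet the line below any given \<open>s0\<close>. The slope is increasing there,
  so its limit at the boundary is its infimum.\<close>

lemma iota_eq: "iota D v x = (INF s\<in>{height x<..}. slope (x + s *\<^sub>R v))"
proof -
  define I where "I = (INF s\<in>{height x<..}. slope (x + s *\<^sub>R v))"
  have lower: "I \<le> slope (x + s *\<^sub>R v)" if "height x < s" for s
    unfolding I_def using that by (intro cINF_lower slope_bdd_below) auto
  have level: "\<forall>\<^sub>F \<epsilon> in at_right 0. \<exists>s. height x < s \<and> s < s0 \<and> iota_eps D v \<epsilon> x = slope (x + s *\<^sub>R v)"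
    if s0: "height x < s0" for s0
  proof -
    have p0: "x + s0 *\<^sub>R v \<in> D"
      using s0 by (simp add: mem_D_iff)
    have "\<exists>s. height x < s \<and> s < s0 \<and> iota_eps D v \<epsilon> x = slope (x + s *\<^sub>R v)"
      if \<epsilon>: "\<epsilon> \<in> {0<..<sqrt (sqtime (x + s0 *\<^sub>R v))}" for \<epsilon>
    proof -
      have \<epsilon>2: "\<epsilon>\<^sup>2 < sqtime (x + s0 *\<^sub>R v)"
        using \<epsilon> real_less_rsqrt real_sqrt_less_iff[of "\<epsilon>\<^sup>2"] by auto
      obtain s1 where s1: "height x < s1" "s1 < s0" "sqtime (x + s1 *\<^sub>R v) < \<epsilon>\<^sup>2"
        using ex_sqtime_less[of "\<epsilon>\<^sup>2" x s0] s0 \<epsilon> by auto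
      have "continuous_on {s1..s0} (\<lambda>s. sqtime (x + s *\<^sub>R v))"
        using s1 by (intro continuous_on_compose2[OF continuous_on_sqtime] continuous_intros)
          (auto simp: mem_D_iff)
      then obtain s where s: "s1 \<le> s" "s \<le> s0" "sqtime (x + s *\<^sub>R v) = \<epsilon>\<^sup>2"
        using IVT'[of "\<lambda>s. sqtime (x + s *\<^sub>R v)" s1 "\<epsilon>\<^sup>2" s0] s1 \<epsilon>2 by auto
      moreover have "s \<noteq> s0"
        using s \<epsilon>2 by auto
      ultimately show ?thesis
        using s1 \<epsilon> iota_eps_eq[of x s \<epsilon>] by (intro exI[of _ s]) auto
    qed
    then show ?thesis
      using sqtime_pos[OF p0]
      by (intro eventually_at_rightI[of 0 "sqrt (sqtime (x + s0 *\<^sub>R v))"]) auto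
  qed
  have "((\<lambda>\<epsilon>. iota_eps D v \<epsilon> x) \<longlongrightarrow> I) (at_right 0)"
  proof (rule order_tendstoI)
    fix a assume "a < I"
    have "\<forall>\<^sub>F \<epsilon> in at_right 0. \<exists>s. height x < s \<and> s < height x + 1 \<and>
        iota_eps D v \<epsilon> x = slope (x + s *\<^sub>R v)"
      by (rule level) simp
    then show "\<forall>\<^sub>F \<epsilon> in at_right 0. a < iota_eps D v \<epsilon> x"
      by eventually_elim (use lower \<open>a < I\<close> in force)
  next
    fix a assume "I < a"
    then obtain s0 where s0: "height x < s0" "slope (x + s0 *\<^sub>R v) < a"
      unfolding I_def using cINF_less_iff[OF greaterThan_non_empty slope_bdd_below] by auto
    have less: "slope (x + s *\<^sub>R v) < a" if "height x < s" "s < s0" for s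
    proof -
      have "x + s *\<^sub>R v \<in> D"
        using that by (simp add: mem_D_iff)
      then have "slope (x + s *\<^sub>R v) + (s0 - s) \<le> slope (x + s *\<^sub>R v + (s0 - s) *\<^sub>R v)"
        using that by (intro slope_shift(2)) auto
      then show ?thesis
        using s0 that by (simp add: algebra_simps)
    qed
    show "\<forall>\<^sub>F \<epsilon> in at_right 0. iota_eps D v \<epsilon> x < a"
      using level[OF s0(1)] by eventually_elim (use less in auto)
  qed
  then show ?thesis
    unfolding iota_def I_def[symmetric] by (intro tendsto_Lim) auto
qed

lemma iota_le:
  assumes "height x < s"
  shows "iota D v x \<le> slope (x + s *\<^sub>R v)"
  unfolding iota_eq using assms by (intro cINF_lower slope_bdd_below) auto

text \<open>The slope at \<open>p\<close> is at most half of every difference quotient of \<open>sqtime\<close> in the direction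
  \<open>v\<close>, and these quotients are continuous in \<open>p\<close>.\<close>

lemma slope_upper_semicontinuous:
  assumes p: "p \<in> D" and a: "slope p < a"
  shows "\<forall>\<^sub>F p' in nhds p. slope p' < a"
proof -
  \<comment> \<open>The expression bounds the difference quotient of \<open>sqtime\<close> at
    \<open>p\<close>. One \<open>h\<close> making it less than \<open>2 * a\<close> is fixed, and
    continuity keeps the quotient below \<open>2 * a\<close> near \<open>p\<close>.\<close>
  have "((\<lambda>h. 2 * slope p + h * ((slope p)\<^sup>2 / sqtime p)) \<longlongrightarrow> 2 * slope p) (at_right 0)"
    using sqtime_pos[OF p] by (auto intro!: tendsto_eq_intros)
  then have "\<forall>\<^sub>F h in at_right 0. 2 * slope p + h * ((slope p)\<^sup>2 / sqtime p) < 2 * a"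
    using a by (intro order_tendstoD) auto
  then obtain h where h: "h > 0" "2 * slope p + h * ((slope p)\<^sup>2 / sqtime p) < 2 * a"
    by (rule eventually_at_right_0_witness)
  note q = slope_shift(1)[OF p h(1)]
  have "sqtime (p + h *\<^sub>R v) - sqtime p \<le> h * (2 * slope p + h * ((slope p)\<^sup>2 / sqtime p))"
    using sqtime_shift_upper[OF p q] by (simp add: power2_eq_square algebra_simps)
  also have "\<dots> < h * (2 * a)"
    using h by (intro mult_strict_left_mono)
  finally have less: "sqtime (p + h *\<^sub>R v) - sqtime p < h * (2 * a)" .
  have cont: "(sqtime \<longlongrightarrow> sqtime y) (nhds y)" if "y \<in> D" for y
    using tendsto_sqtime[OF that] at_within_open[OF that D_open] by (simp add: tendsto_nhds_iff)
  have "((\<lambda>p'. p' + h *\<^sub>R v) \<longlongrightarrow> p + h *\<^sub>R v) (nhds p)"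
    by (intro tendsto_intros filterlim_ident)
  from filterlim_compose[OF cont[OF q] this]
  have "((\<lambda>p'. sqtime (p' + h *\<^sub>R v) - sqtime p') \<longlongrightarrow> sqtime (p + h *\<^sub>R v) - sqtime p) (nhds p)"
    by (intro tendsto_diff cont[OF p])
  then have "\<forall>\<^sub>F p' in nhds p. sqtime (p' + h *\<^sub>R v) - sqtime p' < h * (2 * a)"
    using less by (rule order_tendstoD)
  moreover have "\<forall>\<^sub>F p' in nhds p. p' \<in> D"
    using D_open p by (rule eventually_nhds_in_open)
  ultimately show ?thesis
  proof eventually_elim
    case (elim p')
    have "h * (2 * slope p') \<le> sqtime (p' + h *\<^sub>R v) - sqtime p'"
      using sqtime_shift_lower[OF elim(2) slope_shift(1)[OF elim(2) h(1)]] zero_le_power2[of h]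
      by linarith
    then have "h * (2 * slope p') < h * (2 * a)"
      using elim(1) by linarith
    then show ?case
      using h(1) by simp
  qed
qed

text \<open>A parameter \<open>s\<close> witnessing the bound at \<open>x\<close> is kept fixed:
  nearby lines still meet \<open>D\<close> at \<open>s\<close>, and the slope there remains below
  \<open>a\<close>.\<close>

lemma iota_upper_semicontinuous: "upper_semicontinuous_on S (iota D v)"
  unfolding upper_semicontinuous_on_def
proof (intro ballI allI impI)
  fix x a assume a: "iota D v x < a"
  then obtain s where s: "height x < s" "slope (x + s *\<^sub>R v) < a"
    unfolding iota_eq using cINF_less_iff[OF greaterThan_non_empty slope_bdd_below] by auto
  have p: "x + s *\<^sub>R v \<in> D"
    using s by (simp add: mem_D_iff)
  have "\<forall>\<^sub>F p' in nhds (x + s *\<^sub>R v). slope p' < a \<and> p' \<in> D"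
    by (intro eventually_conj slope_upper_semicontinuous s p eventually_nhds_in_open D_open)
  moreover have "((\<lambda>y. y + s *\<^sub>R v) \<longlongrightarrow> x + s *\<^sub>R v) (at x within S)"
    by (intro tendsto_intros)
  ultimately have "\<forall>\<^sub>F y in at x within S. slope (y + s *\<^sub>R v) < a \<and> y + s *\<^sub>R v \<in> D"
    by (rule eventually_compose_filterlim)
  then show "\<forall>\<^sub>F y in at x within S. iota D v y < a"
    by eventually_elim (use iota_le in \<open>fastforce simp: mem_D_iff\<close>)
qed

end


section \<open>Lightlike rays in the boundary\<close>

lemma start_in_ray: "p \<in> ray p n"
  unfolding ray_def by (auto intro: exI[of _ 0])

lemma ray_scaleR:
  assumes "k > 0"
  shows "ray p (k *\<^sub>R n) = ray p n"
proof -
  have "\<exists>s\<ge>0. t = s * k" if "t \<ge> 0" for t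
    using assms that by (intro exI[of _ "t / k"]) auto
  then show ?thesis
    unfolding ray_def using assms by fastforce
qed

lemma ray_subset_parallel:
  assumes sub: "ray p n \<subseteq> ray p' n'" and n: "n \<noteq> 0"
  obtains k t where "k > 0" "t \<ge> 0" "n = k *\<^sub>R n'" "p = p' + t *\<^sub>R n'"
proof -
  have mem: "\<exists>s\<ge>0. p + t *\<^sub>R n = p' + s *\<^sub>R n'" if "t \<ge> 0" for t
    using sub that by (force simp: ray_def)
  obtain t where t: "t \<ge> 0" "p = p' + t *\<^sub>R n'"
    using mem[of 0] by auto
  obtain s where s: "s \<ge> 0" "p + n = p' + s *\<^sub>R n'"
    using mem[of 1] by auto
  define k where "k = s - t"
  have nk: "n = k *\<^sub>R n'"
    using s t by (simp add: k_def algebra_simps)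
  with n have n': "n' \<noteq> 0" and k0: "k \<noteq> 0"
    by auto
  have "k > 0"
  proof (rule ccontr)
    assume "\<not> k > 0"
    with k0 have k: "k < 0" by simp
    \<comment> \<open>For negative \<open>k\<close> this parameter reaches \<open>p' - n'\<close>, a
      point before the start of the larger ray.\<close>
    have "(t + 1) / (- k) \<ge> 0"
      using t(1) k by (intro divide_nonneg_pos) auto
    then obtain s' where s': "s' \<ge> 0" "p + ((t + 1) / (- k)) *\<^sub>R n = p' + s' *\<^sub>R n'"
      using mem by blast
    have "((t + 1) / (- k)) *\<^sub>R n = (- (t + 1)) *\<^sub>R n'"
      using k by (simp add: nk)
    then have "(1 + s') *\<^sub>R n' = 0"
      using s'(2) unfolding t(2) by (simp add: algebra_simps)
    then have "1 + s' = 0"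
      using n' by (simp only: scaleR_eq_0_iff) simp
    with s'(1) show False by simp
  qed
  with t nk that show thesis by blast
qed

section \<open>Existence and uniqueness of the past endpoint\<close>

context dependence_domain
begin

lemma frontier_eq: "frontier D = closure D - D"
  by (simp add: frontier_def interior_open[OF D_open])

lemma frontier_future_notin:
  assumes "p \<in> frontier D" "future_timelike w"
  shows "p + w \<notin> frontier D"
  using closure_timelike_future[of p w] assms by (simp add: frontier_eq)

text \<open>The normal of a null support plane is tangent to that plane, so moving along it
  preserves the level that excludes membership in \<open>D\<close>.\<close>

lemma ex_null_ray:
  assumes q: "q \<in> frontier D"
  shows "\<exists>n. lightlike n \<and> n $ 0 > 0 \<and> ray q n \<subseteq> frontier D"
proof -
  have qc: "q \<in> closure D" and qD: "q \<notin> D"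
    using q by (auto simp: frontier_eq)
  obtain n c where n: "lightlike n" "n $ 0 > 0" "c \<le> mink q n" "\<And>y. y \<in> D \<Longrightarrow> mink y n < c"
    using null_support_outside[OF qD] by metis
  have "q + t *\<^sub>R n \<in> frontier D" if "t \<ge> 0" for t
  proof -
    have "q + t *\<^sub>R n \<in> closure D"
      using closure_future[OF qc future_causal_scaleR[OF lightlike_future_causal[OF n(1,2)]], of t] qc that
      by (cases "t = 0") auto
    moreover have "mink (q + t *\<^sub>R n) n \<ge> c"
      using n by (simp add: mink_algebra lightlike_def)
    then have "q + t *\<^sub>R n \<notin> D"
      using n(4) by fastforce
    ultimately show ?thesis
      by (simp add: frontier_eq)
  qed
  with n show ?thesis
    by (intro exI[of _ n]) (auto simp: ray_def)
qed

text \<open>The ray is prolonged backwards as far as \<open>closure D\<close> allows, which is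
  finite by \<open>timelike_bound\<close>. Prolonged points stay outside \<open>D\<close>, as
  otherwise moving on along \<open>n\<close> would bring points of the given ray into
  \<open>D\<close>.\<close>

lemma ex_maximal_ray:
  assumes n: "lightlike n" "n $ 0 > 0" and ray: "ray q n \<subseteq> frontier D"
  shows "\<exists>t\<ge>0. maximal_lightlike_ray (frontier D) (ray (q - t *\<^sub>R n) n)"
proof -
  define S where "S = {t. t \<ge> 0 \<and> q - t *\<^sub>R n \<in> closure D}"
  have rayD: "q + t *\<^sub>R n \<in> frontier D" if "t \<ge> 0" for t
    using ray that by (auto simp: ray_def)
  obtain m c where m: "future_timelike m" "\<And>y. y \<in> closure D \<Longrightarrow> mink y m \<le> c"
    using timelike_bound by blast
  have nm: "mink n m < 0"
    using future_timelike_causal_neg[OF m(1) lightlike_future_causal[OF n]] by (simp add: mink_commute)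
  have "t \<le> (c - mink q m) / (- mink n m)" if "t \<in> S" for t
    using m(2)[of "q - t *\<^sub>R n"] that nm
    by (simp add: S_def mink_algebra pos_le_divide_eq[of "- mink n m"] del: divide_minus_right)
  then have bdd: "bdd_above S"
    by (intro bdd_aboveI)
  have "0 \<in> S"
    using rayD[of 0] by (simp add: S_def frontier_eq)
  then have ne: "S \<noteq> {}" by blast
  have "closed ({0..} \<inter> (\<lambda>t. q - t *\<^sub>R n) -` closure D)"
    by (intro closed_Int closed_vimage continuous_intros closed_closure)
  then have "closed S"
    by (simp add: S_def vimage_def Int_def)
  define t where "t = Sup S"
  have tS: "t \<in> S"
    unfolding t_def using closed_contains_Sup[OF ne bdd \<open>closed S\<close>] .
  have tmax: "s \<le> t" if "s \<in> S" for s
    unfolding t_def by (rule cSup_upper[OF that bdd])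
  define p where "p = q - t *\<^sub>R n"
  have pc: "p \<in> closure D" and t0: "t \<ge> 0"
    using tS by (auto simp: S_def p_def)
  have shift: "y + s *\<^sub>R n \<in> D" if "y \<in> D" "s \<ge> 0" for y s
    using D_future[OF _ future_causal_scaleR[OF lightlike_future_causal[OF n]], of y s] that
    by (cases "s = 0") auto
  have "p + s *\<^sub>R n \<in> frontier D" if "s \<ge> 0" for s
  proof -
    have "p + s *\<^sub>R n \<in> closure D"
      using closure_future[OF pc future_causal_scaleR[OF lightlike_future_causal[OF n]], of s] pc that
      by (cases "s = 0") auto
    moreover have "p + s *\<^sub>R n \<notin> D"
    proof
      assume "p + s *\<^sub>R n \<in> D"
      then have "p + s *\<^sub>R n + t *\<^sub>R n \<in> D"
        using t0 by (rule shift)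
      then have "q + s *\<^sub>R n \<in> D"
        by (simp add: p_def)
      then show False
        using rayD[OF that] by (simp add: frontier_eq)
    qed
    ultimately show ?thesis
      by (simp add: frontier_eq)
  qed
  then have sub: "ray p n \<subseteq> frontier D"
    by (auto simp: ray_def)
  have "R' = ray p n" if R': "lightlike_ray R'" "R' \<subseteq> frontier D" "ray p n \<subseteq> R'" for R'
  proof -
    obtain p' n' where pn': "lightlike n'" "R' = ray p' n'"
      using R'(1) by (auto simp: lightlike_ray_def)
    have "n \<noteq> 0"
      using n by (simp add: lightlike_def)
    then obtain k s where k: "k > 0" "s \<ge> 0" "n = k *\<^sub>R n'" "p = p' + s *\<^sub>R n'"
      using ray_subset_parallel R'(3) pn'(2) by metis
    have "p' \<in> closure D"
      using R'(2) pn'(2) start_in_ray[of p' n'] by (auto simp: frontier_eq)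
    \<comment> \<open>The start of a larger ray belongs to \<open>S\<close>, so maximality of
      \<open>t\<close> forces \<open>s = 0\<close>.\<close>
    moreover have "p' = q - (t + s / k) *\<^sub>R n"
      using k(1,4) unfolding p_def k(3) by (simp add: algebra_simps eq_diff_eq diff_eq_eq)
    ultimately have "t + s / k \<in> S"
      using t0 k by (simp add: S_def)
    then have "s / k \<le> 0"
      using tmax by fastforce
    then have "s = 0"
      using k by (simp add: divide_le_eq)
    then show ?thesis
      using k pn'(2) by (simp add: ray_scaleR)
  qed
  moreover have "lightlike_ray (ray p n)"
    using n by (auto simp: lightlike_ray_def)
  ultimately show ?thesis
    using sub t0 unfolding maximal_lightlike_ray_def p_def by blast
qed

text \<open>Two maximal rays through an interior point of one of them lie on a common line, since otherwise
  the sum of their directions would be timelike.\<close>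

lemma maximal_ray_start_unique:
  assumes n: "lightlike n" "n $ 0 > 0" and n': "lightlike n'" "n' $ 0 > 0"
    and q: "q \<in> ray p n" "q \<in> ray p' n'"
    and max: "maximal_lightlike_ray (frontier D) (ray p n)"
      "maximal_lightlike_ray (frontier D) (ray p' n')"
  shows "p = p'"
proof -
  \<comment> \<open>The case where \<open>q\<close> is not the start of the first ray; the other
    cases follow by exchanging the rays or are trivial.\<close>
  have aux: "p = p'"
    if n: "lightlike n" "n $ 0 > 0" and n': "lightlike n'" "n' $ 0 > 0"
      and q: "q \<in> ray p n" "q \<in> ray p' n'" and ne: "q \<noteq> p"
      and max: "maximal_lightlike_ray (frontier D) (ray p n)"
        "maximal_lightlike_ray (frontier D) (ray p' n')"
    for p n p' n'
  proof -
    obtain t where t: "t \<ge> 0" "q = p + t *\<^sub>R n"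
      using q(1) by (auto simp: ray_def)
    have t0: "t > 0"
      using t ne by (cases "t = 0") auto
    obtain t' where t': "t' \<ge> 0" "q = p' + t' *\<^sub>R n'"
      using q(2) by (auto simp: ray_def)
    have pf: "p \<in> frontier D"
      using max(1) start_in_ray[of p n] by (auto simp: maximal_lightlike_ray_def)
    \<comment> \<open>Going one unit beyond \<open>q\<close> gives \<open>n'\<close> a positive
      coefficient in the displacement from \<open>p\<close>, even if \<open>q = p'\<close>.\<close>
    have "p' + (t' + 1) *\<^sub>R n' \<in> ray p' n'"
      using t'(1) by (auto simp: ray_def intro!: exI[of _ "t' + 1"])
    then have "p' + (t' + 1) *\<^sub>R n' \<in> frontier D"
      using max(2) by (auto simp: maximal_lightlike_ray_def)
    moreover have "p' + (t' + 1) *\<^sub>R n' = p + (n' + t *\<^sub>R n)"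
      using t(2) unfolding t'(2) by (simp add: algebra_simps)
    ultimately have "\<not> future_timelike (n' + t *\<^sub>R n)"
      using frontier_future_notin[OF pf] by auto
    then obtain k where k: "n' = k *\<^sub>R (t *\<^sub>R n)"
      using lightlike_not_proportional_add[OF n', of "t *\<^sub>R n"] lightlike_scaleR[OF n(1), of t] n(2) t0
      by auto
    define l where "l = k * t"
    have nl: "n' = l *\<^sub>R n"
      by (simp add: k l_def)
    have l: "l > 0"
      using n(2) n'(2) nl by (simp add: zero_less_mult_iff)
    have ray': "ray p' n' = ray p' n"
      unfolding nl by (rule ray_scaleR[OF l])
    define d where "d = t - t' * l"
    have p': "p' = p + d *\<^sub>R n"
      using t(2) unfolding t'(2) nl by (simp add: d_def algebra_simps)
    have shift: "ray (x + s *\<^sub>R n) n \<subseteq> ray x n" if "s \<ge> 0" for x s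
    proof
      fix y assume "y \<in> ray (x + s *\<^sub>R n) n"
      then obtain r where "r \<ge> 0" "y = x + s *\<^sub>R n + r *\<^sub>R n"
        by (auto simp: ray_def)
      then have "s + r \<ge> 0" "y = x + (s + r) *\<^sub>R n"
        using that by (auto simp: algebra_simps)
      then show "y \<in> ray x n"
        unfolding ray_def by blast
    qed
    have "ray p n = ray p' n"
    proof (cases "d \<ge> 0")
      case True
      then have "ray p' n \<subseteq> ray p n"
        unfolding p' by (rule shift)
      then show ?thesis
        using max unfolding ray' maximal_lightlike_ray_def by blast
    next
      case False
      then have "ray (p' + (- d) *\<^sub>R n) n \<subseteq> ray p' n"
        by (intro shift) simp
      then have "ray p n \<subseteq> ray p' n"
        by (simp add: p')
      then show ?thesis
        using max unfolding ray' maximal_lightlike_ray_def by blast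
    qed
    moreover have "n \<noteq> 0"
      using n by (simp add: lightlike_def)
    moreover have "a = b" if "ray a n = ray b n" "n \<noteq> 0" for a b
    proof -
      have "a \<in> ray b n" "b \<in> ray a n"
        using that(1) start_in_ray by blast+
      then obtain r s where rs: "r \<ge> 0" "s \<ge> 0" "a = b + r *\<^sub>R n" "b = a + s *\<^sub>R n"
        unfolding ray_def by blast
      then have "(r + s) *\<^sub>R n = 0"
        by (simp add: algebra_simps)
      then show ?thesis
        using that(2) rs by (auto simp: add_nonneg_eq_0_iff)
    qed
    ultimately show ?thesis
      by blast
  qed
  show ?thesis
  proof (cases "q = p \<and> q = p'")
    case False
    then show ?thesis
      using aux[OF n n' q _ max] aux[OF n' n q(2) q(1) _ max(2) max(1)] by blast
  qed auto
qed

lemma past_endpoint_eq: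
  assumes n: "lightlike n" "n $ 0 > 0" and q: "q \<in> ray p n"
    and max: "maximal_lightlike_ray (frontier D) (ray p n)"
  shows "past_endpoint D q = p"
  unfolding past_endpoint_def
proof (rule the_equality)
  show "\<exists>n. lightlike n \<and> n $ 0 > 0 \<and> q \<in> ray p n \<and> maximal_lightlike_ray (frontier D) (ray p n)"
    using assms by blast
  fix p' assume "\<exists>n. lightlike n \<and> n $ 0 > 0 \<and> q \<in> ray p' n \<and>
      maximal_lightlike_ray (frontier D) (ray p' n)"
  then show "p' = p"
    using maximal_ray_start_unique[OF _ _ n _ q _ max] by blast
qed

end

section \<open>Semicontinuity of \<open>I_fun\<close>\<close>

context observer
begin

definition foot :: "real^3 \<Rightarrow> real^3" where
  "foot x = x + height x *\<^sub>R v"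

lemma foot_frontier: "foot x \<in> frontier D"
  by (simp add: foot_def mem_frontier_iff)

text \<open>Prolonging the ray to a maximal one reveals the past endpoint at parameter
  \<open>a + t\<close>, and the normalisation of \<open>n\<close> makes this parameter the value of
  \<open>I_fun\<close>.\<close>

lemma I_fun_ge:
  assumes n: "lightlike n" "n $ 0 > 0" "mink n v = -1" and a: "a \<ge> 0"
    and ray: "ray (foot x - a *\<^sub>R n) n \<subseteq> frontier D"
  shows "a \<le> I_fun D v x" and "ray (foot x - I_fun D v x *\<^sub>R n) n \<subseteq> frontier D"
proof -
  obtain t where t: "t \<ge> 0"
    and max: "maximal_lightlike_ray (frontier D) (ray (foot x - a *\<^sub>R n - t *\<^sub>R n) n)"
    using ex_maximal_ray[OF n(1,2) ray] by blast
  have p: "foot x - a *\<^sub>R n - t *\<^sub>R n = foot x - (a + t) *\<^sub>R n"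
    by (simp add: algebra_simps)
  have "foot x \<in> ray (foot x - (a + t) *\<^sub>R n) n"
    using a t by (auto simp: ray_def intro!: exI[of _ "a + t"])
  then have "past_endpoint D (foot x) = foot x - (a + t) *\<^sub>R n"
    using past_endpoint_eq[OF n(1,2)] max p by simp
  then have I: "I_fun D v x = a + t"
    by (simp add: I_fun_def height_def[symmetric] foot_def[symmetric] mink_algebra n(3))
  then show "a \<le> I_fun D v x"
    using t by simp
  show "ray (foot x - I_fun D v x *\<^sub>R n) n \<subseteq> frontier D"
    using max unfolding I p by (simp add: maximal_lightlike_ray_def)
qed

lemma I_fun_attained:
  obtains n where "lightlike n" "n $ 0 > 0" "mink n v = -1" "I_fun D v x \<ge> 0"
    "ray (foot x - I_fun D v x *\<^sub>R n) n \<subseteq> frontier D"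
proof -
  obtain n0 where n0: "lightlike n0" "n0 $ 0 > 0" "ray (foot x) n0 \<subseteq> frontier D"
    using ex_null_ray[OF foot_frontier] by blast
  have vn0: "mink n0 v < 0"
    using future_timelike_causal_neg[OF v lightlike_future_causal[OF n0(1,2)]]
    by (simp add: mink_commute)
  define k where "k = - 1 / mink n0 v"
  have k: "k > 0"
    using vn0 by (simp add: k_def)
  have n: "lightlike (k *\<^sub>R n0)" "(k *\<^sub>R n0) $ 0 > 0" "mink (k *\<^sub>R n0) v = -1"
    using n0(2) k vn0 by (auto intro!: lightlike_scaleR n0(1) simp: mink_algebra(5))
      (simp add: k_def)
  have "ray (foot x - 0 *\<^sub>R (k *\<^sub>R n0)) (k *\<^sub>R n0) \<subseteq> frontier D"
    using n0(3) by (simp add: ray_scaleR[OF k])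
  from I_fun_ge[OF n order_refl this] n that show thesis
    by blast
qed

lemma height_isCont: "isCont height x"
  unfolding isCont_def
proof (rule order_tendstoI)
  fix b assume "height x < b"
  then have "x + b *\<^sub>R v \<in> D"
    by (simp add: mem_D_iff)
  moreover have "((\<lambda>y. y + b *\<^sub>R v) \<longlongrightarrow> x + b *\<^sub>R v) (at x)"
    by (intro tendsto_intros)
  ultimately show "\<forall>\<^sub>F y in at x. height y < b"
    using topological_tendstoD[OF _ D_open] by (fastforce simp: mem_D_iff)
next
  fix b assume "b < height x"
  then have "x + b *\<^sub>R v \<in> - closure D"
    by (simp add: mem_closure_iff)
  moreover have "((\<lambda>y. y + b *\<^sub>R v) \<longlongrightarrow> x + b *\<^sub>R v) (at x)"
    by (intro tendsto_intros)
  ultimately have "\<forall>\<^sub>F y in at x. y + b *\<^sub>R v \<in> - closure D"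
    by (intro topological_tendstoD open_Compl closed_closure)
  then show "\<forall>\<^sub>F y in at x. b < height y"
    by (simp add: mem_closure_iff not_le)
qed

lemma foot_isCont: "isCont foot x"
  unfolding foot_def by (intro continuous_intros height_isCont)

text \<open>The weak inequality \<open>0 \<le> n $ 0\<close> keeps the set closed, while the
  normalisation excludes \<open>n = 0\<close>.\<close>

lemma compact_null_directions: "compact {n. mink n n = 0 \<and> 0 \<le> n $ 0 \<and> mink n v = -1}"
proof -
  obtain B where B: "B > 0" "\<And>w. mink w w \<le> 0 \<Longrightarrow> w $ 0 \<ge> 0 \<Longrightarrow> norm w \<le> B * (- mink w v)"
    using causal_norm_bound[OF v] by blast
  have "bounded {n. mink n n = 0 \<and> 0 \<le> n $ 0 \<and> mink n v = -1}"
    using B(2) by (intro boundedI[of _ B]) force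
  moreover have "closed ({n. mink n n = 0} \<inter> {n. 0 \<le> n $ 0} \<inter> {n. mink n v = -1})"
    by (intro closed_Int closed_Collect_eq closed_Collect_le continuous_intros)
  then have "closed {n. mink n n = 0 \<and> 0 \<le> n $ 0 \<and> mink n v = -1}"
    by (simp add: Collect_conj_eq Int_assoc)
  ultimately show ?thesis
    by (simp add: compact_eq_bounded_closed)
qed

text \<open>If \<open>I_fun\<close> stayed at least \<open>a\<close> along a sequence tending to
  \<open>x\<close>, a subsequence of the ray directions would converge. The frontier is closed, so
  the limit ray lies in it and \<open>I_fun_ge\<close> gives \<open>a\<close> as a lower bound at
  \<open>x\<close>.\<close>

lemma I_fun_upper_semicontinuous: "upper_semicontinuous_on S (I_fun D v)"
  unfolding upper_semicontinuous_on_def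
proof (intro ballI allI impI)
  fix x a assume "x \<in> S" and a: "I_fun D v x < a"
  have a0: "a \<ge> 0"
    using a I_fun_attained[of x] by (metis less_imp_le order_trans)
  show "\<forall>\<^sub>F y in at x within S. I_fun D v y < a"
  proof (rule sequentially_imp_eventually_within, intro allI impI, elim conjE)
    fix y assume y: "y \<longlonglongrightarrow> x" and ys: "\<forall>k. y k \<in> S \<and> y k \<noteq> x"
    show "\<forall>\<^sub>F k in sequentially. I_fun D v (y k) < a"
    proof (rule ccontr)
      assume "\<not> (\<forall>\<^sub>F k in sequentially. I_fun D v (y k) < a)"
      then obtain \<rho> :: "nat \<Rightarrow> nat" where \<rho>: "strict_mono \<rho>" "\<And>k. \<not> I_fun D v (y (\<rho> k)) < a"
        using not_eventually_sequentiallyD by blast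
      define z where "z k = y (\<rho> k)" for k
      have z: "z \<longlonglongrightarrow> x" and zI: "\<And>k. a \<le> I_fun D v (z k)"
        using LIMSEQ_subseq_LIMSEQ[OF y \<rho>(1)] \<rho>(2) by (auto simp: z_def[abs_def] o_def not_less)
      define N where "N = {n. mink n n = 0 \<and> 0 \<le> n $ 0 \<and> mink n v = -1}"
      \<comment> \<open>The rays are cut to start at distance parameter \<open>a\<close>, so that
        their starting points converge whatever the values of \<open>I_fun\<close> along the
        sequence.\<close>
      have "\<exists>n. n \<in> N \<and> (\<forall>s\<ge>0. foot (z k) - a *\<^sub>R n + s *\<^sub>R n \<in> frontier D)" for k
      proof -
        obtain n where n: "lightlike n" "n $ 0 > 0" "mink n v = -1"
          and ray: "ray (foot (z k) - I_fun D v (z k) *\<^sub>R n) n \<subseteq> frontier D"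
          using I_fun_attained[of "z k"] by blast
        have "foot (z k) - a *\<^sub>R n + s *\<^sub>R n \<in> frontier D" if "s \<ge> 0" for s
        proof -
          have "foot (z k) - a *\<^sub>R n + s *\<^sub>R n =
              foot (z k) - I_fun D v (z k) *\<^sub>R n + (I_fun D v (z k) - a + s) *\<^sub>R n"
            by (simp add: algebra_simps)
          moreover have "I_fun D v (z k) - a + s \<ge> 0"
            using zI[of k] that by simp
          ultimately show ?thesis
            using ray unfolding ray_def by blast
        qed
        with n show ?thesis
          by (auto simp: lightlike_def N_def)
      qed
      then have "\<exists>n. \<forall>k. n k \<in> N \<and> (\<forall>s\<ge>0. foot (z k) - a *\<^sub>R n k + s *\<^sub>R n k \<in> frontier D)"
        by (intro choice allI)
      then obtain n where n: "\<forall>k. n k \<in> N \<and> (\<forall>s\<ge>0. foot (z k) - a *\<^sub>R n k + s *\<^sub>R n k \<in> frontier D)" ..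
      have nN: "n k \<in> N" for k
        using n by blast
      have fr: "foot (z k) - a *\<^sub>R n k + s *\<^sub>R n k \<in> frontier D" if "s \<ge> 0" for k s
        using n that by blast
      obtain m \<phi> where m: "m \<in> N" and \<phi>: "strict_mono \<phi>" "(n \<circ> \<phi>) \<longlonglongrightarrow> m"
        using compact_null_directions[folded N_def] nN unfolding compact_def by blast
      have "(\<lambda>k. foot (z (\<phi> k))) \<longlonglongrightarrow> foot x"
        using foot_isCont LIMSEQ_subseq_LIMSEQ[OF z \<phi>(1)]
        by (auto simp: o_def intro: isCont_tendsto_compose)
      then have lim: "(\<lambda>k. foot (z (\<phi> k)) - a *\<^sub>R n (\<phi> k) + s *\<^sub>R n (\<phi> k))
          \<longlonglongrightarrow> foot x - a *\<^sub>R m + s *\<^sub>R m" for s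
        using \<phi>(2) unfolding o_def by (intro tendsto_intros)
      have "foot x - a *\<^sub>R m + s *\<^sub>R m \<in> frontier D" if "s \<ge> 0" for s
        by (rule closed_sequentially[OF frontier_closed fr[OF that] lim])
      then have ray: "ray (foot x - a *\<^sub>R m) m \<subseteq> frontier D"
        by (auto simp: ray_def)
      have "m \<noteq> 0"
        using m[unfolded N_def] by (auto simp: mink_algebra)
      then have lm: "lightlike m"
        using m[unfolded N_def] by (simp add: lightlike_def)
      then have "m $ 0 > 0"
        using m[unfolded N_def] lightlike_time_nonzero[OF lm] by (simp add: less_le)
      then have "a \<le> I_fun D v x"
        using I_fun_ge(1)[OF lm _ _ a0 ray] m[unfolded N_def] by simp
      with a show False by simp
    qed
  qed
qed

end

theorem proposition3p6:
  fixes D :: "(real^3) set" and v :: "real^3"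
  assumes "domain_of_dependence D"
    and "future_timelike v" and "mink v v = -1"
  shows "upper_semicontinuous_on (orth_plane v) (iota D v)
      \<and> meagre_in (top_of_set (orth_plane v))
           {x \<in> orth_plane v. \<not> continuous (at x within orth_plane v) (iota D v)}
      \<and> upper_semicontinuous_on (orth_plane v) (I_fun D v)"
proof -
  interpret observer D v
    using assms by unfold_locales
  show ?thesis
    by (intro conjI iota_upper_semicontinuous I_fun_upper_semicontinuous
        upper_semicontinuous_discontinuities_meagre)
qed

end
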